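(* Let $\alpha=\operatorname{ord}\mathcal{S}_H=\sup_{f=h+\overline{g}\in\mathcal{S}_H}|h''(0)/2|$, and for $r\in(0,1)$ let $$C(r)=\frac{1}{4\alpha r}\left(\frac{1-r}{1+r}\right)^{\alpha}\left[1-\left(\frac{1-r}{1+r}\right)^{2\alpha}\right].$$ Then $C$ is strictly decreasing on $(0,1)$, and for every $f=h+\overline{g}\in\mathcal{S}_H^0$, every $r\in(0,1)$ and all $z_1,z_2$ with $|z_1|=|z_2|=r$, $$|f(z_2)-f(z_1)|\ge|z_2-z_1|\,C(r).$$
   Context: $\mathbb{D}=\{z\in\mathbb{C}:|z|<1\}$. $\mathcal{S}_H$ is the family of univalent (injective), sense-preserving harmonic functions $f=h+\overline{g}$ on $\mathbb{D}$, with $h,g$ analytic on $\mathbb{D}$, normalized by $h(0)=g(0)=0$ and $h'(0)=1$. Sense-preserving means that the Jacobian $J_f(z)=|h'(z)|^2-|g'(z)|^2$ is positive on $\mathbb{D}$. $\mathcal{S}_H^0$ is the subfamily of those $f\in\mathcal{S}_H$ with $f_{\overline{z}}(0)=0$, i.e. $g'(0)=0$. *)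

theory Defs
  imports "HOL-Complex_Analysis.Complex_Analysis"
begin

abbreviation unit_disc :: "complex set" where
  "unit_disc \<equiv> ball 0 1"

text \<open>Functions on the disc are total functions on the complex plane whose values outside the disc
  are irrelevant. The normalization \<open>g 0 = 0\<close> makes \<open>h\<close> and \<open>g\<close> unique on the disc.\<close>

definition canonical_rep ::
  "(complex \<Rightarrow> complex) \<Rightarrow> (complex \<Rightarrow> complex) \<Rightarrow> (complex \<Rightarrow> complex) \<Rightarrow> bool" where
  "canonical_rep f h g \<longleftrightarrow>
     h holomorphic_on unit_disc \<and> g holomorphic_on unit_disc \<and> g 0 = 0 \<and>
     (\<forall>z\<in>unit_disc. f z = h z + cnj (g z))"

definition harmonic_jacobian :: "(complex \<Rightarrow> complex) \<Rightarrow> (complex \<Rightarrow> complex) \<Rightarrow> complex \<Rightarrow> real" where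
  "harmonic_jacobian h g z = (cmod (deriv h z))\<^sup>2 - (cmod (deriv g z))\<^sup>2"

definition S_H :: "(complex \<Rightarrow> complex) set" where
  "S_H = {f. inj_on f unit_disc \<and>
     (\<exists>h g. canonical_rep f h g \<and> (\<forall>z\<in>unit_disc. harmonic_jacobian h g z > 0) \<and>
            h 0 = 0 \<and> deriv h 0 = 1)}"

text \<open>For \<open>f = h + cnj g\<close> the derivative of \<open>f\<close> with respect to \<open>cnj z\<close> is \<open>cnj (deriv g z)\<close>.\<close>

definition S_H0 :: "(complex \<Rightarrow> complex) set" where
  "S_H0 = {f \<in> S_H. \<exists>h g. canonical_rep f h g \<and> deriv g 0 = 0}"

text \<open>This is a supremum in the reals, so it is meaningful only for a family whose second
  coefficients are bounded; \<open>S_H\<close> is such a family by a theorem of Clunie and Sheil-Small.\<close>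

definition family_ord :: "(complex \<Rightarrow> complex) set \<Rightarrow> real" where
  "family_ord F = Sup {cmod (deriv (deriv h) 0 / 2) | f h g. f \<in> F \<and> canonical_rep f h g}"

definition C_bound :: "real \<Rightarrow> real \<Rightarrow> real" where
  "C_bound \<alpha> r = 1 / (4 * \<alpha> * r) * ((1 - r) / (1 + r)) powr \<alpha> *
     (1 - ((1 - r) / (1 + r)) powr (2 * \<alpha>))"

end

theory Submission
  imports Defs
begin

text \<open>
  Write \<open>f = h + cnj g\<close>, and let \<open>\<alpha>\<close> be the order of the family. The point of the order is that the
  family is invariant under two operations: Koebe transforms, that is precomposition with a disc
  automorphism followed by renormalisation, and postcomposition with affine maps
  \<open>w \<mapsto> w + \<epsilon> * cnj w\<close> where \<open>\<bar>\<epsilon>\<bar> < 1\<close>. So one bound on the second coefficient at the origin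
  is a differential inequality at every point of the disc.

  \<^bold>\<open>The estimate.\<close> The Koebe transform turns \<open>\<bar>h''(0)\<bar> \<le> 2 \<alpha> \<bar>h'(0)\<bar>\<close> into
  \<open>\<bar>(1 - \<bar>a\<bar>\<^sup>2) h''(a) / h'(a) - 2 cnj a\<bar> \<le> 2 \<alpha>\<close>, and integration along a ray bounds \<open>\<bar>h'\<bar>\<close> from below
  by \<open>\<bar>h'(0)\<bar>\<close> times the explicit factor \<open>distortion \<alpha>\<close>. The affine map replaces \<open>h'\<close> by
  \<open>h' + \<epsilon> g'\<close>; the best choice of \<open>\<epsilon>\<close> gives the same bound for \<open>\<bar>h'\<bar> - \<bar>g'\<bar>\<close>, the least
  stretching factor of \<open>f\<close>, relative to its value at the origin (\<open>min_stretch_ge_distortion\<close>); that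
  value is \<open>1\<close> when \<open>g'(0) = 0\<close>. Pulling a straight segment in the image back
  to the disc and integrating the least stretching along the pulled-back path bounds
  \<open>\<bar>f(z) - f(0)\<bar>\<close> from below by \<open>growth \<alpha> \<bar>z\<bar>\<close> times the stretching at the origin
  (\<open>norm_ge_growth\<close>). One more Koebe transform moves
  the origin to \<open>z\<^sub>1\<close>, which gives a bound in terms of the pseudo-hyperbolic distance of
  \<open>z\<^sub>1\<close> and \<open>z\<^sub>2\<close> (\<open>two_point_distortion\<close>). On the circle \<open>\<bar>z\<bar> = r\<close> this bound is a concave function
  of the chord length \<open>\<bar>z\<^sub>2 - z\<^sub>1\<bar>\<close>, so it lies above the chord of its graph from \<open>0\<close> to the diameter
  \<open>2 r\<close> (\<open>growth_chord\<close>), and the slope of that chord yields \<open>C_bound \<alpha> r\<close>.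

  \<^bold>\<open>Finiteness of the order.\<close> All this needs the second coefficients to be bounded, since otherwise the
  real supremum says nothing. The bound comes from a rescaling argument in the style of Zalcman. If
  \<open>h''/h'\<close> is enormous at the origin, blow up \<open>f\<close> around a point where \<open>(1/2 - \<bar>z\<bar>) * \<bar>h''/h'\<bar>\<close> is
  maximal. On a huge disc the rescaled map has \<open>H''/H'\<close> bounded and equal to \<open>1\<close> at the centre, and
  its dilatation \<open>G'/H'\<close> is bounded by \<open>1\<close>. By the quantitative Liouville theorem contained in the
  Schwarz lemma both are nearly constant, so that up to an affine map the rescaled function is nearly
  \<open>exp\<close>. A map close to \<open>exp\<close> takes a value near the origin that it also takes near \<open>2 \<pi> \<i>\<close>, which
  contradicts injectivity (\<open>univalent_harmonic_second_coeff_bounded\<close>).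

  \<^bold>\<open>Monotonicity.\<close> With \<open>T = (1 - r) / (1 + r)\<close>, a decreasing convex function of \<open>r\<close>, the bound is a
  multiple of \<open>T\<^sup>\<alpha>\<close> times the slope \<open>(1 - T\<^sup>2\<^sup>\<alpha>) / r\<close> of a chord of a concave function. This uses
  \<open>2 \<alpha> \<ge> 1\<close>, which the polynomial \<open>z + z\<^sup>2 / 2\<close> provides.
\<close>

section \<open>Harmonic maps close to the exponential function\<close>

text \<open>Near the origin \<open>exp z - 1\<close> is close to the identity, so by Brouwer's fixed point theorem \<open>P\<close>
  attains every small value there; one such value is \<open>P (2 \<pi> \<i>)\<close>, because \<open>exp\<close> has period
  \<open>2 \<pi> \<i>\<close>. The radius \<open>7\<close> only has to exceed \<open>2 \<pi>\<close>.\<close>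

lemma near_exp_not_inj:
  fixes P :: "complex \<Rightarrow> complex"
  assumes cont: "continuous_on (cball 0 7) P"
    and near: "\<And>z. cmod z \<le> 7 \<Longrightarrow> cmod (P z - (exp z - 1)) \<le> 1/16"
  shows "\<not> inj_on P (cball 0 7)"
proof
  assume inj: "inj_on P (cball 0 7)"
  define w :: complex where "w = 2 * of_real pi * \<i>"
  have w: "cmod w \<le> 7" "cmod w \<ge> 1" "exp w = 1"
    using pi_less_4 pi_ge_two pi_approx unfolding w_def by (auto simp: norm_mult)
  \<comment> \<open>The fixed points of \<open>T\<close> are the solutions of \<open>P z = P w\<close>.\<close>
  define T where "T = (\<lambda>z. z - P z + P w)"
  have "T z \<in> cball 0 (1/4)" if "z \<in> cball 0 (1/4)" for z
  proof -
    have z: "cmod z \<le> 1/4" using that by simp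
    have "cmod (exp z - (1 + z)) \<le> exp \<bar>Re z\<bar> * (cmod z)^2"
      using Taylor_exp[of z 1] by (simp add: power2_eq_square)
    also have "\<dots> \<le> 2 * (1/4)^2"
    proof (intro mult_mono power_mono z)
      have "\<bar>Re z\<bar> \<le> 1/2" using abs_Re_le_cmod[of z] z by linarith
      then have "exp \<bar>Re z\<bar> \<le> 1 + 2 * \<bar>Re z\<bar>" using exp_bound_lemma[of "\<bar>Re z\<bar>"] by simp
      then show "exp \<bar>Re z\<bar> \<le> 2" using \<open>\<bar>Re z\<bar> \<le> 1/2\<close> by linarith
    qed auto
    finally have 1: "cmod (exp z - (1 + z)) \<le> 1/8" by (simp add: power2_eq_square)
    have 2: "cmod (P z - (exp z - 1)) \<le> 1/16" using near z by simp
    have 3: "cmod (P w) \<le> 1/16" using near[OF w(1)] w(3) by simp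
    have "T z = P w - (P z - (exp z - 1)) - (exp z - (1 + z))" by (simp add: T_def)
    then have "cmod (T z) \<le> cmod (P w) + cmod (P z - (exp z - 1)) + cmod (exp z - (1 + z))"
      using norm_triangle_ineq4[of "P w" "P z - (exp z - 1)"]
        norm_triangle_ineq4[of "P w - (P z - (exp z - 1))" "exp z - (1 + z)"] by simp
    then show ?thesis using 1 2 3 by simp
  qed
  moreover have "continuous_on (cball 0 (1/4)) T"
    unfolding T_def by (intro continuous_intros continuous_on_subset[OF cont]) auto
  ultimately obtain z where z: "z \<in> cball 0 (1/4)" "T z = z"
    using brouwer_ball[of "1/4" 0 T] by (auto simp: Pi_iff)
  then have "P z = P w" by (simp add: T_def)
  then have "z = w" using inj z w by (auto simp: inj_on_def)
  then show False using z w by simp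
qed

lemma Schwarz_Lemma_ball:
  assumes hol: "f holomorphic_on ball 0 R" and f0: "f 0 = 0" and R: "R > 0" and c: "c > 0"
    and no: "\<And>z. cmod z < R \<Longrightarrow> cmod (f z) < c"
    and z: "cmod z < R"
  shows "cmod (f z) \<le> c * cmod z / R"
proof -
  define F where "F = (\<lambda>w. f (of_real R * w) / of_real c)"
  have "F holomorphic_on ball 0 1"
    unfolding F_def using R c
    by (intro holomorphic_intros holomorphic_on_compose_gen[OF _ hol, unfolded o_def])
       (auto simp: norm_mult)
  moreover have "F 0 = 0" by (simp add: F_def f0)
  moreover have "cmod (F w) < 1" if "cmod w < 1" for w
    using no[of "of_real R * w"] that R c by (simp add: F_def norm_mult norm_divide)
  moreover have "cmod (z / of_real R) < 1" using z R by (simp add: norm_divide)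
  ultimately have "cmod (F (z / of_real R)) \<le> cmod (z / of_real R)"
    by (rule Schwarz_Lemma(1))
  then show ?thesis using R c by (simp add: F_def norm_divide field_simps)
qed

lemma pseudohyperbolic_less_1:
  assumes "cmod w < 1" "cmod b < 1"
  shows "1 - cnj b * w \<noteq> 0" "cmod ((w - b) / (1 - cnj b * w)) < 1"
    "cmod (1 - cnj b * w)^2 = (1 - cmod w^2) * (1 - cmod b^2) + cmod (w - b)^2"
proof -
  show eq: "cmod (1 - cnj b * w)^2 = (1 - cmod w^2) * (1 - cmod b^2) + cmod (w - b)^2"
    by (simp only: cmod_power2) (simp add: algebra_simps power2_eq_square)
  have pos: "(1 - cmod w^2) * (1 - cmod b^2) > 0"
    using assms by (intro mult_pos_pos) (auto simp: power_less_one_iff)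
  show ne: "1 - cnj b * w \<noteq> 0"
  proof
    assume "1 - cnj b * w = 0"
    then have "(1 - cmod w^2) * (1 - cmod b^2) + cmod (w - b)^2 = 0" using eq by simp
    then show False using pos by (smt (verit) zero_le_power2)
  qed
  have "cmod (w - b)^2 < cmod (1 - cnj b * w)^2" using eq pos by linarith
  then have "cmod (w - b) < cmod (1 - cnj b * w)" by (rule power2_less_imp_less) simp
  then show "cmod ((w - b) / (1 - cnj b * w)) < 1" using ne by (simp add: norm_divide)
qed

text \<open>A form of the Schwarz--Pick lemma that stays useful when \<open>\<bar>\<omega> 0\<bar>\<close> is close to \<open>1\<close>: the variation
  of \<open>\<omega>\<close> is small relative to \<open>1 - \<bar>\<omega> 0\<bar>\<^sup>2\<close>, which is the factor lost when a dilatation \<open>\<omega> 0\<close> is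
  removed by an affine map.\<close>

lemma Schwarz_Pick_centred:
  assumes hol: "\<omega> holomorphic_on ball 0 R" and R: "R > 0"
    and no: "\<And>z. cmod z < R \<Longrightarrow> cmod (\<omega> z) < 1" and z: "cmod z \<le> R/2"
  shows "cmod (\<omega> z - \<omega> 0) \<le> 2 * (cmod z / R) * (1 - (cmod (\<omega> 0))^2)"
proof -
  define b where "b = \<omega> 0"
  have b: "cmod b < 1" using no[of 0] R by (simp add: b_def)
  have zR: "cmod z < R" using z R by simp
  define \<phi> where "\<phi> = (\<lambda>z. (\<omega> z - b) / (1 - cnj b * \<omega> z))"
  have "\<phi> holomorphic_on ball 0 R"
    unfolding \<phi>_def using pseudohyperbolic_less_1(1)[OF no b]
    by (intro holomorphic_intros hol) auto
  then have "cmod (\<phi> z) \<le> 1 * cmod z / R"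
    by (rule Schwarz_Lemma_ball) (use R zR pseudohyperbolic_less_1(2)[OF no b] in \<open>auto simp: \<phi>_def b_def\<close>)
  then have "cmod (\<omega> z - b) \<le> (cmod z / R) * cmod (1 - cnj b * \<omega> z)"
    using pseudohyperbolic_less_1(1)[OF no[OF zR] b] by (simp add: \<phi>_def norm_divide field_simps)
  also have "\<dots> \<le> (cmod z / R) * ((1 - cmod b^2) + cmod (\<omega> z - b))"
  proof (rule mult_left_mono)
    have "1 - cnj b * \<omega> z = of_real (1 - cmod b^2) - cnj b * (\<omega> z - b)"
      using complex_norm_square[of b] by (simp add: algebra_simps)
    also have "cmod \<dots> \<le> cmod (of_real (1 - cmod b^2)) + cmod (cnj b * (\<omega> z - b))"
      by (rule norm_triangle_ineq4)
    also have "\<dots> = (1 - cmod b^2) + cmod b * cmod (\<omega> z - b)"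
      using b by (simp only: norm_of_real norm_mult complex_mod_cnj) (simp add: power_le_one_iff)
    also have "\<dots> \<le> (1 - cmod b^2) + cmod (\<omega> z - b)"
      using b by (simp add: mult_left_le_one_le)
    finally show "cmod (1 - cnj b * \<omega> z) \<le> (1 - cmod b^2) + cmod (\<omega> z - b)" .
  qed (use R in auto)
  also have "\<dots> \<le> (cmod z / R) * (1 - cmod b^2) + (1/2) * cmod (\<omega> z - b)"
    unfolding distrib_left using z R by (intro add_left_mono mult_right_mono) (auto simp: field_simps)
  finally show ?thesis unfolding b_def by simp
qed

lemma holomorphic_on_ball_of_derivative:
  assumes "\<And>z. cmod z < R \<Longrightarrow> (f has_field_derivative f' z) (at z)"
  shows "f holomorphic_on ball 0 R"
  using assms by (intro holomorphic_onI)
    (auto simp: field_differentiable_def intro!: exI DERIV_subset[OF assms])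

lemma norm_exp_minus_1_le:
  assumes "cmod d \<le> 1/2" shows "cmod (exp d - 1) \<le> 2 * cmod d"
proof -
  have "cmod (exp d - 1) \<le> exp \<bar>Re d\<bar> * cmod d"
    using Taylor_exp[of d 0] by simp
  also have "\<dots> \<le> 2 * cmod d"
  proof (rule mult_right_mono)
    have *: "\<bar>Re d\<bar> \<le> 1/2" using abs_Re_le_cmod[of d] assms by linarith
    then have "exp \<bar>Re d\<bar> \<le> 1 + 2 * \<bar>Re d\<bar>" using exp_bound_lemma[of "\<bar>Re d\<bar>"] by simp
    then show "exp \<bar>Re d\<bar> \<le> 2" using * by linarith
  qed auto
  finally show ?thesis .
qed

lemma norm_exp_le_cball_7: "cmod z \<le> 7 \<Longrightarrow> cmod (exp z) \<le> 2187"
proof -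
  assume "cmod z \<le> 7"
  then have "cmod (exp z) \<le> exp (7 * (1::real))" using complex_Re_le_cmod[of z] by simp
  also have "\<dots> = exp 1 ^ 7" using exp_of_nat_mult[of 7 "1::real"] by simp
  also have "\<dots> \<le> 3 ^ 7" by (intro power_mono exp_le) auto
  finally show ?thesis by simp
qed

lemma holomorphic_log_with_derivative:
  assumes hol: "f holomorphic_on ball 0 R" and nz: "\<And>z. cmod z < R \<Longrightarrow> f z \<noteq> 0"
  obtains q where "\<And>z. cmod z < R \<Longrightarrow> f z = exp (q z)"
    "\<And>z. cmod z < R \<Longrightarrow> (q has_field_derivative deriv f z / f z) (at z)"
proof -
  obtain q where q: "q holomorphic_on ball 0 R" "\<And>z. z \<in> ball 0 R \<Longrightarrow> f z = exp (q z)"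
    using contractible_imp_holomorphic_log[OF hol convex_imp_contractible[OF convex_ball]] nz
    by (metis dist_0_norm mem_ball)
  have "(q has_field_derivative deriv f z / f z) (at z)" if "cmod z < R" for z
  proof -
    have z: "z \<in> ball 0 R" using that by simp
    note q' = holomorphic_derivI[OF q(1) open_ball z, of UNIV]
    have "((\<lambda>z. exp (q z)) has_field_derivative exp (q z) * deriv q z) (at z)"
      by (rule DERIV_chain2[OF DERIV_exp q'])
    moreover have "((\<lambda>z. exp (q z)) has_field_derivative deriv f z) (at z)"
      by (rule has_field_derivative_transform_within_open[OF holomorphic_derivI[OF hol open_ball z] open_ball z])
         (use q in auto)
    ultimately have "deriv f z = exp (q z) * deriv q z" by (rule DERIV_unique[symmetric])
    then have "deriv q z = deriv f z / f z" using q(2)[OF z] by simp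
    then show ?thesis using q' by simp
  qed
  then show ?thesis using that q by simp
qed

text \<open>A quantitative Liouville theorem. The logarithmic derivative \<open>p = H2 / H1\<close> is bounded on a disc of
  huge radius \<open>M\<close> and equals \<open>1\<close> at the centre, so the Schwarz lemma gives \<open>p = 1 + O(1 / M)\<close> on
  \<open>cball 0 7\<close>. Integrating twice shows that \<open>H1\<close> differs from \<open>exp\<close> by \<open>O(1 / M)\<close>.\<close>

lemma logderiv_bound_imp_near_exp:
  assumes M: "M \<ge> 10^9"
    and der: "\<And>z. cmod z < M \<Longrightarrow> (H1 has_field_derivative H2 z) (at z)"
    and nz: "\<And>z. cmod z < M \<Longrightarrow> H1 z \<noteq> 0"
    and init: "H1 0 = 1" "H2 0 = 1"
    and bd: "\<And>z. cmod z < M \<Longrightarrow> cmod (H2 z) \<le> 2 * cmod (H1 z)"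
    and z: "cmod z \<le> 7"
  shows "cmod (H1 z - exp z) \<le> 10^6 / M"
proof -
  have hol: "H1 holomorphic_on ball 0 M"
    by (rule holomorphic_on_ball_of_derivative[OF der])
  have H2: "H2 z = deriv H1 z" if "z \<in> ball 0 M" for z
    using DERIV_imp_deriv[OF der] that by simp
  then have hol2: "H2 holomorphic_on ball 0 M"
    using holomorphic_deriv[OF hol open_ball] holomorphic_cong by blast
  define p where "p = (\<lambda>z. H2 z / H1 z)"
  have p1: "cmod (p z - 1) \<le> 4 * cmod z / M" if "cmod z < M" for z
  proof (rule Schwarz_Lemma_ball[of "\<lambda>z. p z - 1"])
    show "(\<lambda>z. p z - 1) holomorphic_on ball 0 M"
      unfolding p_def using nz by (intro holomorphic_intros hol hol2) auto
    fix z assume z: "cmod z < M"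
    have "cmod (p z) \<le> 2" using bd[OF z] nz[OF z] by (simp add: p_def norm_divide field_simps)
    then show "cmod (p z - 1) < 4" using norm_triangle_ineq4[of "p z" 1] by simp
  qed (use M init that in \<open>auto simp: p_def\<close>)
  obtain q where q: "\<And>z. cmod z < M \<Longrightarrow> H1 z = exp (q z)"
    "\<And>z. cmod z < M \<Longrightarrow> (q has_field_derivative deriv H1 z / H1 z) (at z)"
    using holomorphic_log_with_derivative[OF hol nz] by blast
  have dq: "(q has_field_derivative p z) (at z)" if "cmod z < M" for z
    using q(2)[OF that] H2[of z] that by (simp add: p_def)
  \<comment> \<open>\<open>d\<close> measures how far the logarithm of \<open>H1\<close> is from the identity.\<close>
  define d where "d = (\<lambda>z. q z - q 0 - z)"
  have "cmod (d z - d 0) \<le> 28 / M * cmod (z - 0)"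
  proof (rule field_differentiable_bound[of "cball 0 7" d "\<lambda>z. p z - 1"])
    fix y :: complex assume "y \<in> cball 0 7"
    then have y: "cmod y \<le> 7" "cmod y < M" using M by auto
    show "(d has_field_derivative p y - 1) (at y within cball 0 7)"
      unfolding d_def by (auto intro!: derivative_eq_intros DERIV_subset[OF dq] y)
    have "4 * cmod y / M \<le> 28 / M" using y M by (intro divide_right_mono) auto
    then show "cmod (p y - 1) \<le> 28 / M" using p1[OF y(2)] by linarith
  qed (use z in auto)
  then have "cmod (d z) \<le> 28 / M * cmod z" by (simp add: d_def)
  also have "\<dots> \<le> 28 / M * 7" using z M by (intro mult_left_mono) auto
  finally have d: "cmod (d z) \<le> 196 / M" by simp
  have zM: "cmod z < M" using z M by simp
  have "exp (q 0) = 1" using q(1)[of 0] init M by simp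
  then have "H1 z = exp z * exp (d z)"
    using q(1)[of z] zM by (simp add: d_def exp_diff)
  then have "H1 z - exp z = exp z * (exp (d z) - 1)" by (simp add: algebra_simps)
  then have "cmod (H1 z - exp z) = cmod (exp z) * cmod (exp (d z) - 1)" by (simp only: norm_mult)
  also have "\<dots> \<le> 2187 * (2 * (196 / M))"
  proof (intro mult_mono norm_exp_le_cball_7 z)
    have "196 / M \<le> 1/2" using M by (simp add: field_simps)
    then have "cmod (d z) \<le> 1/2" using d by linarith
    then show "cmod (exp (d z) - 1) \<le> 2 * (196 / M)" using norm_exp_minus_1_le[of "d z"] d by simp
  qed auto
  also have "\<dots> \<le> 10^6 / M" using M by (simp add: divide_right_mono)
  finally show ?thesis .
qed

text \<open>The function \<open>H1\<close> is close to \<open>exp\<close> and the dilatation \<open>G1 / H1\<close> is close to its value \<open>b\<close> at the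
  centre. For constant dilatation \<open>b\<close> the map would be \<open>u \<mapsto> u + cnj (b * u)\<close> applied to \<open>exp - 1\<close>,
  up to a translation. Undoing this affine map costs a factor \<open>1 / (1 - \<bar>b\<bar>\<^sup>2)\<close>, which the centred
  Schwarz--Pick estimate absorbs.\<close>

lemma harmonic_near_exp_not_inj:
  fixes H G H1 G1 H2 :: "complex \<Rightarrow> complex"
  assumes M: "M \<ge> 10^9"
    and dH: "\<And>z. cmod z < M \<Longrightarrow> (H has_field_derivative H1 z) (at z)"
    and dH1: "\<And>z. cmod z < M \<Longrightarrow> (H1 has_field_derivative H2 z) (at z)"
    and dG: "\<And>z. cmod z < M \<Longrightarrow> (G has_field_derivative G1 z) (at z)"
    and dom: "\<And>z. cmod z < M \<Longrightarrow> cmod (G1 z) < cmod (H1 z)"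
    and init: "H1 0 = 1" "H2 0 = 1"
    and bd: "\<And>z. cmod z < M \<Longrightarrow> cmod (H2 z) \<le> 2 * cmod (H1 z)"
  shows "\<not> inj_on (\<lambda>z. H z + cnj (G z)) (ball 0 M)"
proof
  assume inj: "inj_on (\<lambda>z. H z + cnj (G z)) (ball 0 M)"
  have M7: "cmod z < M" if "cmod z \<le> 7" for z :: complex using that M by simp
  have nz: "H1 z \<noteq> 0" if "cmod z < M" for z using dom[OF that] by auto
  have near: "cmod (H1 z - exp z) \<le> 10^6 / M" if "cmod z \<le> 7" for z
    by (rule logderiv_bound_imp_near_exp[OF M dH1 nz init bd that])
  have M6: "10^6 / M \<le> 1/1000" using M by (simp add: field_simps)
  have H1_le: "cmod (H1 z) \<le> 2188" if "cmod z \<le> 7" for z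
    using near[OF that] norm_exp_le_cball_7[OF that] M6 norm_triangle_sub[of "H1 z" "exp z"]
    by linarith
  define \<omega> where "\<omega> = (\<lambda>z. G1 z / H1 z)"
  define b where "b = \<omega> 0"
  define s where "s = 1 - (cmod b)^2"
  have holG1: "G1 holomorphic_on ball 0 M"
  proof -
    have "G holomorphic_on ball 0 M"
      by (rule holomorphic_on_ball_of_derivative[OF dG])
    moreover have "G1 z = deriv G z" if "z \<in> ball 0 M" for z
      using DERIV_imp_deriv[OF dG] that by simp
    ultimately show ?thesis using holomorphic_deriv[OF _ open_ball] holomorphic_cong by blast
  qed
  have holH1: "H1 holomorphic_on ball 0 M"
    by (rule holomorphic_on_ball_of_derivative[OF dH1])
  have hol: "\<omega> holomorphic_on ball 0 M"
    unfolding \<omega>_def using nz by (intro holomorphic_intros holG1 holH1) auto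
  have lt1: "cmod (\<omega> z) < 1" if "cmod z < M" for z
    using dom[OF that] nz[OF that] by (simp add: \<omega>_def norm_divide)
  have s: "s > 0" using lt1[of 0] M by (simp add: s_def b_def power_less_one_iff abs_square_less_1)
  have \<omega>b: "cmod (\<omega> z - b) \<le> 14 / M * s" if "cmod z \<le> 7" for z
  proof -
    have "cmod (\<omega> z - b) \<le> 2 * (cmod z / M) * s"
      unfolding b_def s_def by (rule Schwarz_Pick_centred[OF hol _ lt1]) (use that M in auto)
    also have "\<dots> \<le> 14 / M * s"
      using that M s by (intro mult_right_mono) (auto simp: divide_right_mono)
    finally show ?thesis .
  qed
  define d where "d = (\<lambda>z. H z - exp z)"
  have dH_le: "cmod (d z - d 0) \<le> 7 * (10^6 / M)" if z: "cmod z \<le> 7" for z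
  proof -
    have "cmod (d z - d 0) \<le> 10^6 / M * cmod (z - 0)"
    proof (rule field_differentiable_bound[of "cball 0 7" d "\<lambda>z. H1 z - exp z"])
      fix y :: complex assume "y \<in> cball 0 7"
      then have y: "cmod y \<le> 7" by simp
      show "(d has_field_derivative H1 y - exp y) (at y within cball 0 7)"
        unfolding d_def by (auto intro!: derivative_eq_intros DERIV_subset[OF dH] M7 y)
    qed (use z near in auto)
    also have "\<dots> \<le> 10^6 / M * 7" using z M by (intro mult_left_mono) auto
    finally show ?thesis by simp
  qed
  \<comment> \<open>\<open>e\<close> is the deviation of \<open>G\<close> from the constant dilatation \<open>b\<close>.\<close>
  define e where "e = (\<lambda>z. G z - b * H z)"
  have e_le: "cmod (e z - e 0) \<le> 10^6 / M * s" if z: "cmod z \<le> 7" for z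
  proof -
    have "cmod (e z - e 0) \<le> 14 / M * s * 2188 * cmod (z - 0)"
    proof (rule field_differentiable_bound[of "cball 0 7" e "\<lambda>z. G1 z - b * H1 z"])
      fix y :: complex assume "y \<in> cball 0 7"
      then have y: "cmod y \<le> 7" by simp
      show "(e has_field_derivative G1 y - b * H1 y) (at y within cball 0 7)"
        unfolding e_def by (auto intro!: derivative_eq_intros DERIV_subset[OF dH] DERIV_subset[OF dG] M7 y)
      have "G1 y - b * H1 y = (\<omega> y - b) * H1 y"
        using nz[OF M7[OF y]] by (simp add: \<omega>_def field_simps)
      then have "cmod (G1 y - b * H1 y) = cmod (\<omega> y - b) * cmod (H1 y)" by (simp only: norm_mult)
      also have "\<dots> \<le> 14 / M * s * 2188"
        by (intro mult_mono \<omega>b H1_le y) (use M s in auto)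
      finally show "cmod (G1 y - b * H1 y) \<le> 14 / M * s * 2188" .
    qed (use z in auto)
    also have "\<dots> \<le> 14 / M * s * 2188 * 7" using z M s by (intro mult_left_mono) auto
    also have "\<dots> \<le> 10^6 / M * s" using M s by (simp add: field_simps)
    finally show ?thesis .
  qed
  define F where "F = (\<lambda>z. (H z - H 0) + cnj (G z - G 0))"
  \<comment> \<open>\<open>w \<mapsto> (w - cnj b * cnj w) / s\<close> is the inverse of \<open>u \<mapsto> u + cnj (b * u)\<close>.\<close>
  define P where "P = (\<lambda>z. (F z - cnj b * cnj (F z)) / of_real s)"
  have sb: "of_real s = 1 - b * cnj b" using complex_norm_square[of b] by (simp add: s_def)
  have P_eq: "P z = (H z - H 0) + (cnj (e z - e 0) - cnj b * (e z - e 0)) / of_real s" for z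
  proof -
    have "F z - cnj b * cnj (F z) = of_real s * (H z - H 0) + (cnj (e z - e 0) - cnj b * (e z - e 0))"
      unfolding sb by (simp add: F_def e_def algebra_simps)
    then show ?thesis using s by (simp add: P_def add_divide_distrib)
  qed
  have "\<not> inj_on P (cball 0 7)"
  proof (rule near_exp_not_inj)
    have "continuous_on (cball 0 7) H" "continuous_on (cball 0 7) G"
      by (rule DERIV_continuous_on, rule DERIV_subset, (rule dH dG, rule M7, simp), simp)+
    then show "continuous_on (cball 0 7) P"
      unfolding P_def F_def using s by (intro continuous_intros) auto
    fix z :: complex assume z: "cmod z \<le> 7"
    have b1: "cmod b \<le> 1" using lt1[of 0] M by (simp add: b_def)
    have "P z - (exp z - 1) = (d z - d 0) + (cnj (e z - e 0) - cnj b * (e z - e 0)) / of_real s"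
      unfolding P_eq d_def by simp
    also have "cmod \<dots> \<le> cmod (d z - d 0) + cmod ((cnj (e z - e 0) - cnj b * (e z - e 0)) / of_real s)"
      by (rule norm_triangle_ineq)
    also have "cmod ((cnj (e z - e 0) - cnj b * (e z - e 0)) / of_real s) \<le> 2 * (10^6 / M)"
    proof -
      have "cmod (cnj (e z - e 0) - cnj b * (e z - e 0)) \<le> cmod (e z - e 0) + cmod b * cmod (e z - e 0)"
        by (metis complex_mod_cnj norm_mult norm_triangle_ineq4)
      also have "\<dots> \<le> 2 * cmod (e z - e 0)" using b1 by (simp add: mult_left_le_one_le)
      also have "\<dots> \<le> 2 * (10^6 / M * s)" using e_le[OF z] by linarith
      finally show ?thesis using s by (simp add: norm_divide field_simps)
    qed
    \<comment> \<open>The size of \<open>M\<close> is dictated by this total error, which must not exceed \<open>1/16\<close>.\<close>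
    finally have "cmod (P z - (exp z - 1)) \<le> 9 * (10^6 / M)" using dH_le[OF z] by linarith
    then show "cmod (P z - (exp z - 1)) \<le> 1/16" using M6 by linarith
  qed
  then obtain x y where xy: "cmod x \<le> 7" "cmod y \<le> 7" "x \<noteq> y" "P x = P y"
    by (auto simp: inj_on_def)
  have "F z = P z + cnj b * cnj (P z)" for z
  proof -
    have "P z + cnj b * cnj (P z)
        = ((F z - cnj b * cnj (F z)) + cnj b * (cnj (F z) - b * F z)) / of_real s"
      by (simp add: P_def add_divide_distrib)
    also have "(F z - cnj b * cnj (F z)) + cnj b * (cnj (F z) - b * F z) = of_real s * F z"
      by (simp add: sb algebra_simps)
    finally show ?thesis using s by simp
  qed
  then have "F x = F y" using xy by simp
  then have "H x + cnj (G x) = H y + cnj (G y)" by (simp add: F_def algebra_simps)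
  then show False using inj xy M7 by (auto simp: inj_on_def)
qed

section \<open>Boundedness of the second coefficients\<close>

text \<open>The class \<open>S_H\<close> without its normalisation at the origin. Unlike \<open>S_H\<close> it is closed under
  precomposition with disc automorphisms and under affine maps with no rescaling.\<close>

definition univalent_harmonic :: "(complex \<Rightarrow> complex) \<Rightarrow> (complex \<Rightarrow> complex) \<Rightarrow> bool" where
  "univalent_harmonic h g \<longleftrightarrow> h holomorphic_on unit_disc \<and> g holomorphic_on unit_disc \<and>
     (\<forall>z\<in>unit_disc. cmod (deriv g z) < cmod (deriv h z)) \<and>
     inj_on (\<lambda>z. h z + cnj (g z)) unit_disc"

lemma univalent_harmonicD:
  assumes "univalent_harmonic h g"
  shows "h holomorphic_on unit_disc" "g holomorphic_on unit_disc"
    "\<And>z. cmod z < 1 \<Longrightarrow> cmod (deriv g z) < cmod (deriv h z)"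
    "\<And>z. cmod z < 1 \<Longrightarrow> deriv h z \<noteq> 0"
    "inj_on (\<lambda>z. h z + cnj (g z)) unit_disc"
    "\<And>z. cmod z < 1 \<Longrightarrow> (h has_field_derivative deriv h z) (at z)"
    "\<And>z. cmod z < 1 \<Longrightarrow> (g has_field_derivative deriv g z) (at z)"
    "\<And>z. cmod z < 1 \<Longrightarrow> (deriv h has_field_derivative deriv (deriv h) z) (at z)"
proof -
  show h: "h holomorphic_on unit_disc" and g: "g holomorphic_on unit_disc"
    and lt: "\<And>z. cmod z < 1 \<Longrightarrow> cmod (deriv g z) < cmod (deriv h z)"
    and "inj_on (\<lambda>z. h z + cnj (g z)) unit_disc"
    using assms by (auto simp: univalent_harmonic_def)
  show "deriv h z \<noteq> 0" if "cmod z < 1" for z using lt[OF that] by auto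
  show "(h has_field_derivative deriv h z) (at z)" if "cmod z < 1" for z
    by (rule holomorphic_derivI[OF h open_ball]) (use that in auto)
  show "(g has_field_derivative deriv g z) (at z)" if "cmod z < 1" for z
    by (rule holomorphic_derivI[OF g open_ball]) (use that in auto)
  show "(deriv h has_field_derivative deriv (deriv h) z) (at z)" if "cmod z < 1" for z
    by (rule holomorphic_derivI[OF holomorphic_deriv[OF h open_ball] open_ball]) (use that in auto)
qed

text \<open>The rescaling argument. At a maximum point \<open>z0\<close> of \<open>\<phi>\<close> the function is enlarged by the factor
  \<open>h''(z0) / h'(z0)\<close>, as a complex number, so that the rescaled logarithmic derivative is exactly \<open>1\<close>
  at the centre; maximality keeps it bounded by \<open>2\<close> on the disc of radius \<open>M = \<phi> z0 / 2\<close>, which is huge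
  as soon as \<open>h''(0) / h'(0)\<close> is.\<close>

lemma univalent_harmonic_second_coeff_bounded:
  assumes uh: "univalent_harmonic h g"
  shows "cmod (deriv (deriv h) 0) \<le> 4 * 10^9 * cmod (deriv h 0)"
proof (rule ccontr)
  note D = univalent_harmonicD[OF uh]
  assume "\<not> ?thesis"
  then have big: "cmod (deriv (deriv h) 0) > 4 * 10^9 * cmod (deriv h 0)" by simp
  define u where "u = (\<lambda>z. deriv (deriv h) z / deriv h z)"
  define \<phi> where "\<phi> = (\<lambda>z. (1/2 - cmod z) * cmod (u z))"
  have "continuous_on (cball 0 (1/2)) \<phi>"
  proof -
    have "continuous_on (cball 0 (1/2)) (deriv h)" "continuous_on (cball 0 (1/2)) (deriv (deriv h))"
      by (auto intro!: holomorphic_on_imp_continuous_on holomorphic_on_subset[OF holomorphic_deriv[OF D(1) open_ball]]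
            holomorphic_on_subset[OF holomorphic_deriv[OF holomorphic_deriv[OF D(1) open_ball] open_ball]])
    then show ?thesis unfolding \<phi>_def u_def using D(4) by (intro continuous_intros) auto
  qed
  then obtain z0 where z0: "cmod z0 \<le> 1/2" and max: "\<And>z. cmod z \<le> 1/2 \<Longrightarrow> \<phi> z \<le> \<phi> z0"
    using continuous_attains_sup[of "cball 0 (1/2)" \<phi>] by auto
  define N where "N = \<phi> z0"
  have "\<phi> 0 > 2 * 10^9"
    using big D(4)[of 0] by (simp add: \<phi>_def u_def norm_divide field_simps)
  then have N: "N > 2 * 10^9" using max[of 0] by (simp add: N_def)
  have "1/2 - cmod z0 \<noteq> 0" "u z0 \<noteq> 0" using N unfolding N_def \<phi>_def by force+
  then have z0': "cmod z0 < 1/2" "u z0 \<noteq> 0" "cmod z0 < 1" using z0 by linarith+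
  define c where "c = inverse (u z0)"
  \<comment> \<open>\<open>\<rho>\<close> is the room left around \<open>z0\<close>; the rescaling \<open>T\<close> below uses half of it.\<close>
  define \<rho> where "\<rho> = 1/2 - cmod z0"
  have \<rho>: "\<rho> > 0" using z0' by (simp add: \<rho>_def)
  have c0: "c \<noteq> 0" "u z0 = inverse c" using z0' by (auto simp: c_def)
  have "cmod c * cmod (u z0) = 1" using z0' by (simp add: c_def flip: norm_mult)
  then have cN: "cmod c * N = \<rho>" by (simp add: N_def \<phi>_def \<rho>_def mult.left_commute)
  define a where "a = deriv h z0"
  have a: "a \<noteq> 0" using D(4)[OF z0'(3)] by (simp add: a_def)
  define M where "M = N / 2"
  define T where "T = (\<lambda>z. z0 + c * z)"
  have T: "cmod (T z) < cmod z0 + \<rho> / 2" if "cmod z < M" for z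
  proof -
    have "cmod (c * z) < cmod c * M" using that c0 by (simp add: norm_mult)
    then show ?thesis using norm_triangle_ineq[of z0 "c * z"] cN by (simp add: T_def M_def)
  qed
  have "cmod z0 + \<rho> / 2 < 1/2" using z0'(1) by (simp add: \<rho>_def field_simps)
  then have "cmod (T z) < 1/2" if "cmod z < M" for z
    using T[OF that] by (rule less_trans[rotated])
  then have T1: "cmod (T z) < 1" "cmod (T z) \<le> 1/2" if "cmod z < M" for z
    using that by (force intro: less_imp_le)+
  have dT: "(T has_field_derivative c) (at z)" for z
    unfolding T_def by (auto intro!: derivative_eq_intros)
  define H where "H = (\<lambda>z. h (T z) / (c * a))"
  define G where "G = (\<lambda>z. g (T z) / cnj (c * a))"
  have "\<not> inj_on (\<lambda>z. H z + cnj (G z)) (ball 0 M)"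
  proof (rule harmonic_near_exp_not_inj)
    show "M \<ge> 10^9" using N by (simp add: M_def)
    fix z assume z: "cmod z < M"
    show "(H has_field_derivative deriv h (T z) / a) (at z)"
      unfolding H_def by (rule DERIV_cong[OF DERIV_cdivide[OF DERIV_chain2[OF D(6)[OF T1(1)[OF z]] dT]]])
        (use c0 in auto)
    show "((\<lambda>z. deriv h (T z) / a) has_field_derivative deriv (deriv h) (T z) * c / a) (at z)"
      by (rule DERIV_cong[OF DERIV_cdivide[OF DERIV_chain2[OF D(8)[OF T1(1)[OF z]] dT]]]) auto
    show "(G has_field_derivative deriv g (T z) * c / cnj (c * a)) (at z)"
      unfolding G_def by (rule DERIV_cdivide[OF DERIV_chain2[OF D(7)[OF T1(1)[OF z]] dT]])
    show "cmod (deriv g (T z) * c / cnj (c * a)) < cmod (deriv h (T z) / a)"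
      using D(3)[OF T1(1)[OF z]] c0 a by (simp add: norm_divide norm_mult divide_strict_right_mono)
    have "\<phi> (T z) \<le> N" using max[OF T1(2)[OF z]] by (simp add: N_def)
    moreover have "(1/2 - cmod (T z)) * cmod (u (T z)) \<ge> \<rho> / 2 * cmod (u (T z))"
      using T[OF z] by (intro mult_right_mono) (auto simp: \<rho>_def field_simps)
    ultimately have "\<rho> / 2 * cmod (u (T z)) \<le> N" by (simp add: \<phi>_def)
    then have "cmod c * cmod (u (T z)) \<le> 2"
      using N unfolding cN[symmetric] by (simp add: field_simps)
    then have "cmod (deriv (deriv h) (T z) * c) \<le> 2 * cmod (deriv h (T z))"
      using D(4)[OF T1(1)[OF z]] by (simp add: u_def norm_divide norm_mult field_simps)
    then show "cmod (deriv (deriv h) (T z) * c / a) \<le> 2 * cmod (deriv h (T z) / a)"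
      using a by (simp add: norm_divide divide_right_mono)
  next
    show "deriv h (T 0) / a = 1" using a by (simp add: T_def a_def)
    show "deriv (deriv h) (T 0) * c / a = 1"
      using c0 a z0' by (simp add: T_def a_def c_def u_def)
  qed
  moreover have "inj_on (\<lambda>z. H z + cnj (G z)) (ball 0 M)"
  proof (rule inj_onI)
    fix x y assume xy: "x \<in> ball 0 M" "y \<in> ball 0 M" "H x + cnj (G x) = H y + cnj (G y)"
    have "H z + cnj (G z) = (h (T z) + cnj (g (T z))) / (c * a)" for z
      by (simp add: H_def G_def add_divide_distrib)
    then have "h (T x) + cnj (g (T x)) = h (T y) + cnj (g (T y))"
      using xy c0 a by simp
    then have "T x = T y" using D(5) T1(1) xy by (auto simp: inj_on_def)
    then show "x = y" using c0 by (simp add: T_def)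
  qed
  ultimately show False by blast
qed

section \<open>The order of the family\<close>

text \<open>The real derivative of such a function is both complex linear and conjugate linear, hence zero.\<close>

lemma holomorphic_eq_cnj_holomorphic_imp_constant:
  assumes \<phi>: "\<phi> holomorphic_on S" and \<psi>: "\<psi> holomorphic_on S" and S: "open S" "connected S"
    and eq: "\<And>z. z \<in> S \<Longrightarrow> \<phi> z = cnj (\<psi> z)" and xy: "x \<in> S" "y \<in> S"
  shows "\<phi> x = \<phi> y"
proof -
  have "(\<phi> has_field_derivative 0) (at z)" if z: "z \<in> S" for z
  proof -
    have d1: "(\<phi> has_field_derivative deriv \<phi> z) (at z)"
      by (rule holomorphic_derivI[OF \<phi> S(1) z])
    have "((\<lambda>z. cnj (\<psi> z)) has_derivative (\<lambda>v. cnj (deriv \<psi> z * v))) (at z)"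
      using holomorphic_derivI[OF \<psi> S(1) z, of UNIV]
      by (intro bounded_linear.has_derivative[OF bounded_linear_cnj]) (simp add: has_field_derivative_def)
    then have "(\<phi> has_derivative (\<lambda>v. cnj (deriv \<psi> z * v))) (at z)"
      by (rule has_derivative_transform_within_open[OF _ S(1) z]) (simp add: eq)
    then have lin: "(\<lambda>v. cnj (deriv \<psi> z * v)) = (*) (deriv \<phi> z)"
      using d1 has_derivative_unique by (auto simp: has_field_derivative_def)
    have "cnj (deriv \<psi> z) = deriv \<phi> z" "cnj (deriv \<psi> z * \<i>) = deriv \<phi> z * \<i>"
      using fun_cong[OF lin, of 1] fun_cong[OF lin, of "\<i>"] by simp_all
    then have "deriv \<phi> z = 0" by simp
    then show ?thesis using d1 by simp
  qed
  then show ?thesis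
    using DERIV_zero_connected_constant[OF S(2,1), of "{}" \<phi>] holomorphic_on_imp_continuous_on[OF \<phi>] xy
    by (metis DERIV_imp_deriv Diff_empty finite.emptyI has_field_derivative_at_within)
qed

lemma canonical_rep_unique:
  assumes r1: "canonical_rep f h g" and r2: "canonical_rep f h' g'" and z: "z \<in> unit_disc"
  shows "h z = h' z" "g z = g' z"
proof -
  have eq: "h w - h' w = cnj (g' w - g w)" if "w \<in> unit_disc" for w
    using r1 r2 that unfolding canonical_rep_def by (simp add: diff_eq_eq algebra_simps)
  have "h z - h' z = h 0 - h' 0"
    by (rule holomorphic_eq_cnj_holomorphic_imp_constant[where S = unit_disc and \<psi> = "\<lambda>w. g' w - g w"])
       (use r1 r2 z eq in \<open>auto simp: canonical_rep_def intro!: holomorphic_intros\<close>)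
  also have "\<dots> = 0" using eq[of 0] r1 r2 by (simp add: canonical_rep_def)
  finally show "h z = h' z" by simp
  then show "g z = g' z" using eq[OF z] by simp
qed

lemma canonical_rep_deriv_unique:
  assumes "canonical_rep f h g" "canonical_rep f h' g'" "z \<in> unit_disc"
  shows "deriv h z = deriv h' z" "deriv g z = deriv g' z" "deriv (deriv h) z = deriv (deriv h') z"
proof -
  note hol = assms(1,2)[unfolded canonical_rep_def]
  note eq = canonical_rep_unique[OF assms(1,2)]
  have H: "(deriv ^^ n) h z = (deriv ^^ n) h' z" for n
    by (rule higher_deriv_transform_within_open[where S = unit_disc]) (use hol eq assms(3) in auto)
  show "deriv h z = deriv h' z" using H[of 1] by simp
  show "deriv (deriv h) z = deriv (deriv h') z" using H[of 2] by (simp add: numeral_2_eq_2)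
  show "deriv g z = deriv g' z"
    by (rule complex_derivative_transform_within_open[where s = unit_disc]) (use hol eq assms(3) in auto)
qed

lemma S_H_obtain:
  assumes "f \<in> S_H"
  obtains h g where "canonical_rep f h g" "univalent_harmonic h g" "h 0 = 0" "deriv h 0 = 1"
proof -
  obtain h g where hg: "canonical_rep f h g" "\<forall>z\<in>unit_disc. harmonic_jacobian h g z > 0"
     "h 0 = 0" "deriv h 0 = 1" and inj: "inj_on f unit_disc"
    using assms unfolding S_H_def by blast
  have "cmod (deriv g z) < cmod (deriv h z)" if "z \<in> unit_disc" for z
    using hg(2) that by (auto simp: harmonic_jacobian_def intro: power2_less_imp_less)
  moreover have "inj_on (\<lambda>z. h z + cnj (g z)) unit_disc"
    using inj hg(1) by (auto simp: canonical_rep_def inj_on_def)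
  ultimately have "univalent_harmonic h g"
    using hg(1) by (auto simp: univalent_harmonic_def canonical_rep_def)
  then show ?thesis using that hg by blast
qed

text \<open>Dividing \<open>f - f 0\<close> by \<open>h'(0)\<close> normalises the holomorphic part; on the conjugated part this is
  division by \<open>cnj (h'(0))\<close>.\<close>

lemma univalent_harmonic_normalise:
  fixes h g
  defines "H \<equiv> (\<lambda>z. (h z - h 0) / deriv h 0)" and "G \<equiv> (\<lambda>z. (g z - g 0) / cnj (deriv h 0))"
  assumes uh: "univalent_harmonic h g"
  shows "(\<lambda>z. H z + cnj (G z)) \<in> S_H" "canonical_rep (\<lambda>z. H z + cnj (G z)) H G"
    "deriv (deriv H) 0 = deriv (deriv h) 0 / deriv h 0"
proof -
  note D = univalent_harmonicD[OF uh]
  have a: "deriv h 0 \<noteq> 0" using D(4) by simp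
  have dH: "deriv H z = deriv h z / deriv h 0" if "cmod z < 1" for z
    unfolding H_def by (rule DERIV_imp_deriv) (auto intro!: derivative_eq_intros D(6) that simp: a)
  have dG: "deriv G z = deriv g z / cnj (deriv h 0)" if "cmod z < 1" for z
    unfolding G_def by (rule DERIV_imp_deriv) (auto intro!: derivative_eq_intros D(7) that simp: a)
  show rep: "canonical_rep (\<lambda>z. H z + cnj (G z)) H G"
    unfolding canonical_rep_def H_def G_def using D(1,2) a by (auto intro!: holomorphic_intros)
  have "H z + cnj (G z) = ((h z + cnj (g z)) - (h 0 + cnj (g 0))) / deriv h 0" for z
    by (simp add: H_def G_def add_divide_distrib diff_divide_distrib)
  then have "inj_on (\<lambda>z. H z + cnj (G z)) unit_disc"
    using D(5) a by (auto simp: inj_on_def)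
  moreover have "harmonic_jacobian H G z > 0" if "z \<in> unit_disc" for z
    using D(3)[of z] that a by (auto simp: harmonic_jacobian_def dH dG norm_divide divide_strict_right_mono intro!: power_strict_mono)
  ultimately show "(\<lambda>z. H z + cnj (G z)) \<in> S_H"
    unfolding S_H_def mem_Collect_eq using rep a
    by (intro conjI exI[of _ H] exI[of _ G]) (auto simp: dH, auto simp: H_def)
  have "deriv (deriv H) 0 = deriv (\<lambda>z. deriv h z / deriv h 0) 0"
    by (rule complex_derivative_transform_within_open[where s = unit_disc])
       (use dH a in \<open>auto intro!: holomorphic_intros holomorphic_deriv[OF _ open_ball] D(1) rep[unfolded canonical_rep_def, THEN conjunct1]\<close>)
  also have "\<dots> = deriv (deriv h) 0 / deriv h 0"
    by (rule DERIV_imp_deriv) (auto intro!: derivative_eq_intros D(8) simp: a)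
  finally show "deriv (deriv H) 0 = deriv (deriv h) 0 / deriv h 0" .
qed

text \<open>A homogeneous form of the statement that \<open>\<alpha>\<close> bounds the order, free of the normalisation.\<close>

definition second_coeff_bound :: "real \<Rightarrow> bool" where
  "second_coeff_bound \<alpha> \<longleftrightarrow> (\<forall>h g. univalent_harmonic h g \<longrightarrow>
     cmod (deriv (deriv h) 0) \<le> 2 * \<alpha> * cmod (deriv h 0))"

text \<open>The set of second coefficients is bounded, so its supremum is an upper bound for it. Uniqueness of
  the canonical representation transfers the bound from the normalised representation of \<open>f\<close> to any other.\<close>

lemma second_coeff_bound_family_ord: "second_coeff_bound (family_ord S_H)"
  unfolding second_coeff_bound_def
proof (intro allI impI)
  define A where "A = {cmod (deriv (deriv h) 0 / 2) | f h g. f \<in> S_H \<and> canonical_rep f h g}"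
  have "x \<le> 2 * 10^9" if "x \<in> A" for x
  proof -
    obtain f h g where *: "x = cmod (deriv (deriv h) 0 / 2)" "f \<in> S_H" "canonical_rep f h g"
      using \<open>x \<in> A\<close> unfolding A_def by blast
    obtain h' g' where **: "canonical_rep f h' g'" "univalent_harmonic h' g'" "deriv h' 0 = 1"
      using S_H_obtain[OF *(2)] by metis
    have "deriv (deriv h) 0 = deriv (deriv h') 0"
      by (rule canonical_rep_deriv_unique(3)[OF *(3) **(1)]) simp
    then show ?thesis
      using univalent_harmonic_second_coeff_bounded[OF **(2)] **(3) *(1) by (simp add: norm_divide)
  qed
  then have bdd: "bdd_above A" by (rule bdd_aboveI)
  fix h g assume uh: "univalent_harmonic h g"
  have a: "deriv h 0 \<noteq> 0" using univalent_harmonicD(4)[OF uh] by simp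
  note N = univalent_harmonic_normalise[OF uh]
  have "cmod (deriv (deriv h) 0 / deriv h 0 / 2) \<in> A"
    unfolding A_def by (rule CollectI, intro exI, rule conjI[OF _ conjI[OF N(1,2)]]) (simp add: N(3))
  then have "cmod (deriv (deriv h) 0 / deriv h 0 / 2) \<le> family_ord S_H"
    unfolding family_ord_def A_def[symmetric] using bdd by (rule cSup_upper)
  then show "cmod (deriv (deriv h) 0) \<le> 2 * family_ord S_H * cmod (deriv h 0)"
    using a by (simp add: norm_divide field_simps)
qed

text \<open>The polynomial \<open>z + z\<^sup>2 / 2\<close> is univalent on the disc and has second coefficient \<open>1/2\<close>.\<close>

lemma second_coeff_bound_ge_half:
  assumes "second_coeff_bound \<alpha>" shows "\<alpha> \<ge> 1/2"
proof -
  define h :: "complex \<Rightarrow> complex" where "h = (\<lambda>z. z + z^2 / 2)"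
  have "(h has_field_derivative 1 + z) (at z)" for z
    unfolding h_def by (auto intro!: derivative_eq_intros)
  then have dh: "deriv h = (\<lambda>z. 1 + z)" by (intro ext DERIV_imp_deriv)
  have ddh: "deriv (deriv h) 0 = 1"
    unfolding dh by (rule DERIV_imp_deriv) (auto intro!: derivative_eq_intros)
  have ne: "1 + z \<noteq> 0" if "cmod z < 1" for z :: complex
    using that by (metis add_eq_0_iff2 norm_minus_cancel norm_one order_less_irrefl add.commute add.inverse_inverse)
  have "inj_on (\<lambda>z. h z + cnj 0) unit_disc"
  proof (rule inj_onI)
    fix x y assume xy: "x \<in> unit_disc" "y \<in> unit_disc" "h x + cnj 0 = h y + cnj 0"
    have "(x - y) * (1 + (x + y) / 2) = h x - h y"
      by (simp add: h_def add_divide_distrib diff_divide_distrib algebra_simps power2_eq_square)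
    then have "(x - y) * (1 + (x + y) / 2) = 0" using xy by simp
    moreover have "cmod ((x + y) / 2) < 1"
      using xy norm_triangle_ineq[of x y] by (simp add: norm_divide)
    ultimately show "x = y" using ne by simp
  qed
  moreover have "h holomorphic_on unit_disc" unfolding h_def by (intro holomorphic_intros) auto
  ultimately have "univalent_harmonic h (\<lambda>_. 0)"
    using ne by (auto simp: univalent_harmonic_def dh)
  then have "cmod (deriv (deriv h) 0) \<le> 2 * \<alpha> * cmod (deriv h 0)"
    using assms unfolding second_coeff_bound_def by blast
  then show ?thesis unfolding ddh by (simp add: dh)
qed

section \<open>Affine and conformal invariance\<close>

text \<open>The new map is \<open>F + \<epsilon> * cnj F\<close> with \<open>F = h + cnj g\<close>.\<close>

lemma univalent_harmonic_affine:
  assumes uh: "univalent_harmonic h g" and \<epsilon>: "cmod \<epsilon> < 1"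
  shows "univalent_harmonic (\<lambda>z. h z + \<epsilon> * g z) (\<lambda>z. g z + cnj \<epsilon> * h z)"
proof -
  note D = univalent_harmonicD[OF uh]
  have d: "deriv (\<lambda>z. h z + \<epsilon> * g z) z = deriv h z + \<epsilon> * deriv g z"
          "deriv (\<lambda>z. g z + cnj \<epsilon> * h z) z = deriv g z + cnj \<epsilon> * deriv h z" if "cmod z < 1" for z
    by (rule DERIV_imp_deriv; auto intro!: derivative_eq_intros D(6,7) that)+
  have "cmod (b + cnj \<epsilon> * a) < cmod (a + \<epsilon> * b)" if "cmod b < cmod a" for a b
  proof (rule power2_less_imp_less)
    have "(cmod (a + \<epsilon> * b))^2 - (cmod (b + cnj \<epsilon> * a))^2
        = (1 - (cmod \<epsilon>)^2) * ((cmod a)^2 - (cmod b)^2)"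
      by (simp only: cmod_power2) (simp add: algebra_simps power2_eq_square)
    moreover have "\<dots> > 0"
      using \<epsilon> that by (intro mult_pos_pos) (auto simp: power_less_one_iff power_strict_mono)
    ultimately show "(cmod (b + cnj \<epsilon> * a))^2 < (cmod (a + \<epsilon> * b))^2" by linarith
  qed simp
  moreover have "inj_on (\<lambda>z. (h z + \<epsilon> * g z) + cnj (g z + cnj \<epsilon> * h z)) unit_disc"
  proof (rule inj_onI)
    define F where "F = (\<lambda>z. h z + cnj (g z))"
    fix x y assume xy: "x \<in> unit_disc" "y \<in> unit_disc"
      "(h x + \<epsilon> * g x) + cnj (g x + cnj \<epsilon> * h x) = (h y + \<epsilon> * g y) + cnj (g y + cnj \<epsilon> * h y)"
    then have "F x - F y = - \<epsilon> * cnj (F x - F y)" by (simp add: F_def algebra_simps)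
    then have "cmod (F x - F y) = cmod \<epsilon> * cmod (F x - F y)"
      by (metis complex_mod_cnj norm_minus_cancel norm_mult)
    then have "F x = F y" using \<epsilon> by auto
    then show "x = y" using D(5) xy by (auto simp: F_def inj_on_def)
  qed
  ultimately show ?thesis
    unfolding univalent_harmonic_def using D(1-3) by (auto simp: d intro!: holomorphic_intros)
qed

definition disc_aut :: "complex \<Rightarrow> complex \<Rightarrow> complex" where
  "disc_aut a z = (z + a) / (1 + cnj a * z)"

context
  fixes a :: complex assumes a: "cmod a < 1"
begin

lemma disc_aut_denom: "cmod z < 1 \<Longrightarrow> 1 + cnj a * z \<noteq> 0"
  using pseudohyperbolic_less_1(1)[of z "-a"] a by simp

lemma disc_aut_in_disc: "cmod z < 1 \<Longrightarrow> cmod (disc_aut a z) < 1"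
  using pseudohyperbolic_less_1(2)[of z "-a"] a by (simp add: disc_aut_def)

lemma disc_aut_minus:
  assumes z: "cmod z < 1" shows "disc_aut a (disc_aut (-a) z) = z"
proof -
  have 1: "1 - cnj a * z \<noteq> 0" using pseudohyperbolic_less_1(1)[of z a] a z by simp
  have 2: "1 - cnj a * a \<noteq> 0" using pseudohyperbolic_less_1(1)[of a a] a by simp
  have "disc_aut (-a) z + a = z * (1 - cnj a * a) / (1 - cnj a * z)"
    using 1 by (simp add: disc_aut_def field_simps)
  moreover have "1 + cnj a * disc_aut (-a) z = (1 - cnj a * a) / (1 - cnj a * z)"
    using 1 by (simp add: disc_aut_def field_simps)
  ultimately show ?thesis using 1 2 by (simp add: disc_aut_def[of a])
qed

lemma has_field_derivative_disc_aut:
  assumes z: "cmod z < 1"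
  shows "(disc_aut a has_field_derivative (1 - cnj a * a) / (1 + cnj a * z)^2) (at z)"
  unfolding disc_aut_def[abs_def] using disc_aut_denom[OF z]
  by (auto intro!: derivative_eq_intros simp: field_simps power2_eq_square)

lemma one_minus_norm_square:
  "1 - cnj a * a = of_real (1 - (cmod a)^2)" "1 - (cmod a)^2 > 0" "1 - cnj a * a \<noteq> 0"
proof -
  show eq: "1 - cnj a * a = of_real (1 - (cmod a)^2)"
    using complex_norm_square[of a] by (simp add: mult.commute)
  show pos: "1 - (cmod a)^2 > 0" using a by (simp add: abs_square_less_1)
  show "1 - cnj a * a \<noteq> 0" unfolding eq using pos by (simp only: of_real_eq_0_iff)
qed

lemma univalent_harmonic_disc_aut:
  assumes uh: "univalent_harmonic h g"
  defines "H \<equiv> (\<lambda>z. h (disc_aut a z))" and "G \<equiv> (\<lambda>z. g (disc_aut a z))"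
  shows "univalent_harmonic H G"
    "deriv H 0 = of_real (1 - (cmod a)^2) * deriv h a"
    "deriv G 0 = of_real (1 - (cmod a)^2) * deriv g a"
    "deriv (deriv H) 0 = of_real (1 - (cmod a)^2) *
        (of_real (1 - (cmod a)^2) * deriv (deriv h) a - 2 * cnj a * deriv h a)"
proof -
  note D = univalent_harmonicD[OF uh]
  define k where "k = (\<lambda>z. (1 - cnj a * a) / (1 + cnj a * z)^2)"
  have k0: "k z \<noteq> 0" if "cmod z < 1" for z
    using disc_aut_denom[OF that] one_minus_norm_square(3) by (simp add: k_def)
  have dT: "(disc_aut a has_field_derivative k z) (at z)" if "cmod z < 1" for z
    unfolding k_def by (rule has_field_derivative_disc_aut[OF that])
  have dH: "(H has_field_derivative deriv h (disc_aut a z) * k z) (at z)"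
    and dG: "(G has_field_derivative deriv g (disc_aut a z) * k z) (at z)"
    if z: "cmod z < 1" for z
    unfolding H_def G_def
    by (rule DERIV_chain2[OF D(6)[OF disc_aut_in_disc[OF z]] dT[OF z]],
        rule DERIV_chain2[OF D(7)[OF disc_aut_in_disc[OF z]] dT[OF z]])
  have holH: "H holomorphic_on unit_disc"
    by (rule holomorphic_on_ball_of_derivative[OF dH])
  have holG: "G holomorphic_on unit_disc"
    by (rule holomorphic_on_ball_of_derivative[OF dG])
  have "inj_on (\<lambda>z. H z + cnj (G z)) unit_disc"
  proof (rule inj_onI)
    fix x y assume xy: "x \<in> unit_disc" "y \<in> unit_disc" "H x + cnj (G x) = H y + cnj (G y)"
    then have "disc_aut a x = disc_aut a y"
      using D(5) disc_aut_in_disc by (auto simp: H_def G_def inj_on_def)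
    then have "(x + a) * (1 + cnj a * y) = (y + a) * (1 + cnj a * x)"
      using disc_aut_denom xy by (simp add: disc_aut_def frac_eq_eq)
    then have "(x - y) * (1 - cnj a * a) = 0" by (simp add: algebra_simps)
    then show "x = y" using one_minus_norm_square(3) by simp
  qed
  moreover have "cmod (deriv G z) < cmod (deriv H z)" if "z \<in> unit_disc" for z
    using that DERIV_imp_deriv[OF dH[of z]] DERIV_imp_deriv[OF dG[of z]] k0[of z] D(3)[OF disc_aut_in_disc[of z]]
    by (simp add: norm_mult)
  ultimately show "univalent_harmonic H G" using holH holG by (simp add: univalent_harmonic_def)
  show "deriv H 0 = of_real (1 - (cmod a)^2) * deriv h a"
    using DERIV_imp_deriv[OF dH[of 0]] one_minus_norm_square(1) by (simp add: k_def disc_aut_def)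
  show "deriv G 0 = of_real (1 - (cmod a)^2) * deriv g a"
    using DERIV_imp_deriv[OF dG[of 0]] one_minus_norm_square(1) by (simp add: k_def disc_aut_def)
  have "((\<lambda>z. deriv h (disc_aut a z) * k z) has_field_derivative
      (deriv (deriv h) (disc_aut a 0) * k 0 * k 0 + deriv h (disc_aut a 0) * (- 2 * cnj a * (1 - cnj a * a)))) (at 0)"
  proof -
    have "(k has_field_derivative (- 2 * cnj a * (1 - cnj a * a))) (at 0)"
      unfolding k_def by (auto intro!: derivative_eq_intros)
    moreover have "((\<lambda>z. deriv h (disc_aut a z)) has_field_derivative deriv (deriv h) (disc_aut a 0) * k 0) (at 0)"
      by (rule DERIV_chain2[OF D(8)[OF disc_aut_in_disc] dT]) auto
    ultimately show ?thesis by (auto intro!: derivative_eq_intros)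
  qed
  then have "(deriv H has_field_derivative
      (deriv (deriv h) (disc_aut a 0) * k 0 * k 0 + deriv h (disc_aut a 0) * (- 2 * cnj a * (1 - cnj a * a)))) (at 0)"
    by (rule has_field_derivative_transform_within_open[of _ _ _ unit_disc])
       (use DERIV_imp_deriv[OF dH] in auto)
  then have "deriv (deriv H) 0 = deriv (deriv h) a * (1 - cnj a * a)^2 + deriv h a * (- 2 * cnj a * (1 - cnj a * a))"
    by (simp add: DERIV_imp_deriv k_def disc_aut_def power2_eq_square)
  then show "deriv (deriv H) 0 = of_real (1 - (cmod a)^2) *
        (of_real (1 - (cmod a)^2) * deriv (deriv h) a - 2 * cnj a * deriv h a)"
    unfolding one_minus_norm_square(1) by (simp add: algebra_simps power2_eq_square)
qed

end

text \<open>The coefficient bound applied to the map precomposed with \<open>disc_aut a\<close>.\<close>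

lemma logderiv_Koebe_bound:
  assumes \<alpha>: "second_coeff_bound \<alpha>" and uh: "univalent_harmonic h g" and a: "cmod a < 1"
  shows "cmod (of_real (1 - (cmod a)^2) * deriv (deriv h) a / deriv h a - 2 * cnj a) \<le> 2 * \<alpha>"
proof -
  note K = univalent_harmonic_disc_aut[OF a uh]
  have nz: "deriv h a \<noteq> 0" using univalent_harmonicD(4)[OF uh a] .
  define s where "s = 1 - (cmod a)^2"
  have s: "s > 0" using one_minus_norm_square(2)[OF a] by (simp add: s_def)
  have "cmod (of_real s * (of_real s * deriv (deriv h) a - 2 * cnj a * deriv h a))
      \<le> 2 * \<alpha> * cmod (of_real s * deriv h a)"
    using \<alpha> K(1) unfolding second_coeff_bound_def K(2,4)[symmetric] s_def by blast
  then have "s * cmod (of_real s * deriv (deriv h) a - 2 * cnj a * deriv h a) \<le> s * (2 * \<alpha> * cmod (deriv h a))"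
    using s by (simp add: norm_mult mult_ac)
  then have "cmod (of_real s * deriv (deriv h) a - 2 * cnj a * deriv h a) \<le> 2 * \<alpha> * cmod (deriv h a)"
    using s by simp
  moreover have "of_real s * deriv (deriv h) a / deriv h a - 2 * cnj a
      = (of_real s * deriv (deriv h) a - 2 * cnj a * deriv h a) / deriv h a"
    using nz by (simp add: field_simps)
  ultimately show ?thesis using nz by (simp add: norm_divide field_simps s_def)
qed

section \<open>Lower bounds for the derivative\<close>

text \<open>With the hyperbolic density \<open>1 / (1 - r\<^sup>2)\<close> and the hyperbolic distance \<open>\<delta>\<close> from the origin in the
  corresponding metric, this is \<open>exp (- 2 * \<alpha> * \<delta>) / (1 - r\<^sup>2)\<close>.\<close>

definition distortion :: "real \<Rightarrow> real \<Rightarrow> real" where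
  "distortion \<alpha> r = ((1 - r) / (1 + r)) powr \<alpha> / (1 - r^2)"

text \<open>The primitive of \<open>distortion \<alpha>\<close> that vanishes at \<open>0\<close>.\<close>

definition growth :: "real \<Rightarrow> real \<Rightarrow> real" where
  "growth \<alpha> r = (1 - ((1 - r) / (1 + r)) powr \<alpha>) / (2 * \<alpha>)"

lemma growth_has_derivative_distortion:
  assumes r: "\<bar>r\<bar> < 1" and \<alpha>: "\<alpha> > 0"
  shows "(growth \<alpha> has_real_derivative distortion \<alpha> r) (at r)"
proof -
  define u where "u = (1 - r) / (1 + r)"
  have u: "u > 0" using r by (simp add: u_def)
  have ne: "1 + r \<noteq> 0" "1 - r \<noteq> 0" "1 - r^2 \<noteq> 0"
    using r by (auto simp: power2_eq_1_iff)
  have "((\<lambda>x. (1 - x) / (1 + x)) has_real_derivative (- 2 / (1 + r)^2)) (at r)"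
    using ne by (auto intro!: derivative_eq_intros simp: field_simps power2_eq_square)
  then have "((\<lambda>x. ((1 - x) / (1 + x)) powr \<alpha>) has_real_derivative \<alpha> * u powr (\<alpha> - 1) * (- 2 / (1 + r)^2)) (at r)"
    using DERIV_chain2[where f = "\<lambda>x. x powr \<alpha>" and g = "\<lambda>x. (1 - x) / (1 + x)",
        OF has_real_derivative_powr[OF u, unfolded u_def]]
    unfolding u_def by blast
  then have "(growth \<alpha> has_real_derivative (0 - \<alpha> * u powr (\<alpha> - 1) * (- 2 / (1 + r)^2)) / (2 * \<alpha>)) (at r)"
    unfolding growth_def[abs_def] by (intro DERIV_cdivide DERIV_diff) auto
  moreover have "(0 - \<alpha> * u powr (\<alpha> - 1) * (- 2 / (1 + r)^2)) / (2 * \<alpha>) = u powr \<alpha> / u / (1 + r)^2"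
    using \<alpha> u by (simp add: powr_diff)
  moreover have "u powr \<alpha> / u / (1 + r)^2 = distortion \<alpha> r"
  proof -
    have "u * (1 + r)^2 = 1 - r^2" using ne by (simp add: u_def power2_eq_square field_simps)
    then show ?thesis unfolding divide_divide_eq_left by (simp add: distortion_def u_def)
  qed
  ultimately show ?thesis by simp
qed

text \<open>Along the ray through \<open>z\<close> the pointwise bound on \<open>h''/h'\<close> controls the derivative of
  \<open>ln \<bar>h'\<bar>\<close> from below; \<open>L\<close> is \<open>ln \<bar>h'\<bar>\<close> minus \<open>ln (distortion \<alpha>)\<close>, and the bound says that \<open>L\<close>
  is nondecreasing.\<close>

lemma norm_deriv_ge_distortion:
  assumes \<alpha>: "second_coeff_bound \<alpha>" and uh: "univalent_harmonic h g" and z: "cmod z < 1"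
  shows "cmod (deriv h 0) * distortion \<alpha> (cmod z) \<le> cmod (deriv h z)"
proof (cases "z = 0")
  case True
  then show ?thesis by (simp add: distortion_def)
next
  case False
  note D = univalent_harmonicD[OF uh]
  obtain q where q: "\<And>z. cmod z < 1 \<Longrightarrow> deriv h z = exp (q z)"
    "\<And>z. cmod z < 1 \<Longrightarrow> (q has_field_derivative deriv (deriv h) z / deriv h z) (at z)"
    using holomorphic_log_with_derivative[of "deriv h" 1] holomorphic_deriv[OF D(1) open_ball] D(4)
    by blast
  define r where "r = cmod z"
  define e where "e = z / of_real r"
  have r: "0 < r" "r < 1" using z False by (auto simp: r_def)
  have e: "cmod e = 1" "z = of_real r * e" using r by (auto simp: e_def norm_divide r_def)
  define L where "L = (\<lambda>\<rho>. Re (q (of_real \<rho> * e)) + (ln (1 - \<rho>^2) - \<alpha> * (ln (1 - \<rho>) - ln (1 + \<rho>))))"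
  have "L 0 \<le> L r"
  proof (rule DERIV_nonneg_imp_nondecreasing[where f = L and a = 0 and b = r])
    fix \<rho> assume "0 \<le> \<rho>" "\<rho> \<le> r"
    then have \<rho>: "0 \<le> \<rho>" "\<rho> < 1" using r by auto
    define a where "a = of_real \<rho> * e"
    have a: "cmod a = \<rho>" "cmod a < 1" using \<rho> e by (auto simp: a_def norm_mult)
    define p where "p = deriv (deriv h) a / deriv h a"
    have \<rho>2: "1 - \<rho>^2 > 0" using \<rho> by (simp add: abs_square_less_1)
    have "((\<lambda>\<rho>. of_real \<rho> * e) has_vector_derivative e) (at \<rho>)"
      by (auto intro!: derivative_eq_intros simp: has_vector_derivative_def scaleR_conv_of_real)
    then have "((q \<circ> (\<lambda>\<rho>. of_real \<rho> * e)) has_vector_derivative e * p) (at \<rho>)"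
      unfolding p_def by (rule field_vector_diff_chain_at) (use q(2)[OF a(2)] in \<open>simp add: a_def\<close>)
    then have "((\<lambda>\<rho>. Re (q (of_real \<rho> * e))) has_real_derivative Re (e * p)) (at \<rho>)"
      using bounded_linear.has_vector_derivative[OF bounded_linear_Re]
      by (simp add: o_def has_real_derivative_iff_has_vector_derivative del: times_complex.sel)
    moreover have "((\<lambda>\<rho>. ln (1 - \<rho>^2) - \<alpha> * (ln (1 - \<rho>) - ln (1 + \<rho>))) has_real_derivative
        (- 2 * \<rho>) / (1 - \<rho>^2) - \<alpha> * (- 1 / (1 - \<rho>) - 1 / (1 + \<rho>))) (at \<rho>)"
      using \<rho> \<rho>2 by (auto intro!: derivative_eq_intros)
    ultimately have dL: "(L has_real_derivative Re (e * p) + ((- 2 * \<rho>) / (1 - \<rho>^2)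
        - \<alpha> * (- 1 / (1 - \<rho>) - 1 / (1 + \<rho>)))) (at \<rho>)"
      unfolding L_def by (rule DERIV_add)
    have "- 1 / (1 - \<rho>) - 1 / (1 + \<rho>) = - 2 / (1 - \<rho>^2)"
      using \<rho> \<rho>2 by (simp add: divide_simps power2_eq_square) (simp add: algebra_simps)
    with dL have "(L has_real_derivative Re (e * p) + (- 2 * \<rho>) / (1 - \<rho>^2) - \<alpha> * (- 2 / (1 - \<rho>^2))) (at \<rho>)"
      by (simp add: add_diff_eq)
    moreover have "Re (e * p) + (- 2 * \<rho>) / (1 - \<rho>^2) - \<alpha> * (- 2 / (1 - \<rho>^2)) \<ge> 0"
    proof -
      have alg: "x + (- 2 * \<rho>) / s - \<alpha> * (- 2 / s) = (s * x - 2 * \<rho> + 2 * \<alpha>) / s"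
        if "s \<noteq> 0" for x s using that by (simp add: field_simps)
      have Re_eq: "Re (of_real x * X - of_real y) = x * Re X - y" for x y X by simp
      have "cmod (of_real (1 - \<rho>^2) * p - 2 * cnj a) \<le> 2 * \<alpha>"
        using logderiv_Koebe_bound[OF \<alpha> uh a(2)] by (simp add: a(1) p_def)
      then have "cmod (e * (of_real (1 - \<rho>^2) * p - 2 * cnj a)) \<le> 2 * \<alpha>"
        by (simp add: norm_mult e)
      also have "e * (of_real (1 - \<rho>^2) * p - 2 * cnj a) = of_real (1 - \<rho>^2) * (e * p) - of_real (2 * \<rho>)"
        using complex_norm_square[of e] e(1) by (simp add: a_def algebra_simps)
      finally have "- (2 * \<alpha>) \<le> Re (of_real (1 - \<rho>^2) * (e * p) - of_real (2 * \<rho>))"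
        using abs_Re_le_cmod[of "of_real (1 - \<rho>^2) * (e * p) - of_real (2 * \<rho>)"] by linarith
      then have "(1 - \<rho>^2) * Re (e * p) - 2 * \<rho> + 2 * \<alpha> \<ge> 0"
        unfolding Re_eq by linarith
      moreover have "Re (e * p) + (- 2 * \<rho>) / (1 - \<rho>^2) - \<alpha> * (- 2 / (1 - \<rho>^2))
          = ((1 - \<rho>^2) * Re (e * p) - 2 * \<rho> + 2 * \<alpha>) / (1 - \<rho>^2)"
        using alg[of "1 - \<rho>^2" "Re (e * p)"] \<rho>2 by simp
      ultimately show ?thesis using \<rho>2 by simp
    qed
    ultimately show "\<exists>y. (L has_real_derivative y) (at \<rho>) \<and> 0 \<le> y" by blast
  qed (use r in auto)
  then have "Re (q 0) + \<alpha> * (ln (1 - r) - ln (1 + r)) - ln (1 - r^2) \<le> Re (q z)"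
    by (simp add: L_def e(2)[symmetric])
  then have "exp (Re (q 0) + \<alpha> * (ln (1 - r) - ln (1 + r)) - ln (1 - r^2)) \<le> exp (Re (q z))"
    by simp
  moreover have "exp (Re (q 0) + \<alpha> * (ln (1 - r) - ln (1 + r)) - ln (1 - r^2))
      = cmod (deriv h 0) * distortion \<alpha> r"
  proof -
    have "1 - r^2 > 0" using r by (simp add: abs_square_less_1)
    then show ?thesis
      using r q(1)[of 0] by (simp add: exp_add exp_diff distortion_def powr_def ln_div)
  qed
  moreover have "cmod (deriv h z) = exp (Re (q z))" using q(1)[OF z] by simp
  ultimately show ?thesis by (simp only: r_def)
qed

text \<open>Apply the previous bound to the affine image with holomorphic part \<open>h + \<epsilon> g\<close>. The argument of
  \<open>\<epsilon>\<close> is chosen so that \<open>\<epsilon> g'(z)\<close> points against \<open>h'(z)\<close>, and \<open>\<bar>\<epsilon>\<bar> = s\<close> tends to \<open>1\<close>.\<close>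

lemma min_stretch_ge_distortion:
  assumes \<alpha>: "second_coeff_bound \<alpha>" and uh: "univalent_harmonic h g" and z: "cmod z < 1"
  shows "(cmod (deriv h 0) - cmod (deriv g 0)) * distortion \<alpha> (cmod z)
    \<le> cmod (deriv h z) - cmod (deriv g z)"
proof -
  note D = univalent_harmonicD[OF uh]
  have dist: "distortion \<alpha> (cmod z) \<ge> 0"
    using z by (simp add: distortion_def abs_square_le_1)
  define X where "X = (cmod (deriv h 0) - cmod (deriv g 0)) * distortion \<alpha> (cmod z)"
  have *: "X + s * cmod (deriv g z) \<le> cmod (deriv h z)" if s: "0 < s" "s < 1" for s :: real
  proof -
    define \<epsilon> where "\<epsilon> = - of_real s * sgn (deriv h z) * cnj (sgn (deriv g z))"
    have "cmod \<epsilon> \<le> s" using s by (simp add: \<epsilon>_def norm_mult norm_sgn)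
    then have \<epsilon>: "cmod \<epsilon> < 1" using s by simp
    have deriv: "deriv (\<lambda>z. h z + \<epsilon> * g z) w = deriv h w + \<epsilon> * deriv g w" if "cmod w < 1" for w
      by (rule DERIV_imp_deriv) (auto intro!: derivative_eq_intros D(6,7) that)
    have "X \<le> cmod (deriv h 0 + \<epsilon> * deriv g 0) * distortion \<alpha> (cmod z)"
      unfolding X_def
    proof (rule mult_right_mono[OF _ dist])
      have "cmod (\<epsilon> * deriv g 0) \<le> cmod (deriv g 0)"
        using \<epsilon> by (simp add: norm_mult mult_left_le_one_le)
      then show "cmod (deriv h 0) - cmod (deriv g 0) \<le> cmod (deriv h 0 + \<epsilon> * deriv g 0)"
        using norm_diff_ineq[of "deriv h 0" "\<epsilon> * deriv g 0"] by linarith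
    qed
    also have "\<dots> \<le> cmod (deriv h z + \<epsilon> * deriv g z)"
      using norm_deriv_ge_distortion[OF \<alpha> univalent_harmonic_affine[OF uh \<epsilon>] z] z by (simp add: deriv)
    also have "deriv h z + \<epsilon> * deriv g z = of_real (cmod (deriv h z) - s * cmod (deriv g z)) * sgn (deriv h z)"
    proof -
      have hz: "deriv h z = of_real (cmod (deriv h z)) * sgn (deriv h z)"
        using D(4)[OF z] by (simp add: sgn_eq)
      have gz: "cnj (sgn (deriv g z)) * deriv g z = of_real (cmod (deriv g z))"
        using complex_norm_square[of "deriv g z"]
        by (cases "deriv g z = 0") (auto simp: sgn_eq power2_eq_square field_simps)
      show ?thesis
        using gz by (subst hz) (simp add: \<epsilon>_def algebra_simps)
    qed
    also have "cmod \<dots> = cmod (deriv h z) - s * cmod (deriv g z)"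
    proof -
      have "s * cmod (deriv g z) \<le> cmod (deriv g z)" using s by (simp add: mult_left_le_one_le)
      then have "s * cmod (deriv g z) \<le> cmod (deriv h z)" using D(3)[OF z] by linarith
      then show ?thesis using D(4)[OF z] by (simp add: norm_mult norm_sgn del: of_real_diff)
    qed
    finally show ?thesis by simp
  qed
  have "X + cmod (deriv g z) \<le> cmod (deriv h z)"
  proof (rule tendsto_upperbound)
    show "((\<lambda>s. X + s * cmod (deriv g z)) \<longlongrightarrow> X + cmod (deriv g z)) (at_left 1)"
      by (auto intro!: tendsto_eq_intros)
    show "\<forall>\<^sub>F s in at_left 1. X + s * cmod (deriv g z) \<le> cmod (deriv h z)"
      using eventually_at_left_real[OF zero_less_one] by (rule eventually_mono) (use * in auto)
  qed auto
  then show ?thesis by (simp add: X_def)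
qed

section \<open>Growth\<close>

lemma univalent_harmonic_has_derivative:
  assumes uh: "univalent_harmonic h g" and z: "cmod z < 1"
  shows "((\<lambda>z. h z + cnj (g z)) has_derivative (\<lambda>v. deriv h z * v + cnj (deriv g z * v))) (at z)"
  using univalent_harmonicD(6,7)[OF uh z]
  by (intro has_derivative_add bounded_linear.has_derivative[OF bounded_linear_cnj])
     (auto simp: has_field_derivative_def)

lemma real_linear_stretch:
  "(cmod a - cmod b) * cmod v \<le> cmod (a * v + cnj (b * v))"
  using norm_diff_ineq[of "a * v" "cnj (b * v)"]
  by (simp add: norm_mult left_diff_distrib)

text \<open>The inverse map expands lengths by at most the reciprocal of the least stretching of \<open>f\<close>. It is
  continuous, with open domain, by invariance of domain.\<close>

lemma univalent_harmonic_inverse: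
  assumes uh: "univalent_harmonic h g"
  defines "f \<equiv> \<lambda>z. h z + cnj (g z)"
  obtains k where "homeomorphism unit_disc (f ` unit_disc) f k"
    "\<And>z. cmod z < 1 \<Longrightarrow> \<exists>B. (k has_derivative B) (at (f z)) \<and>
       (\<forall>w. (cmod (deriv h z) - cmod (deriv g z)) * cmod (B w) \<le> cmod w)"
proof -
  note D = univalent_harmonicD[OF uh]
  have df: "(f has_derivative (\<lambda>v. deriv h z * v + cnj (deriv g z * v))) (at z)" if "cmod z < 1" for z
    unfolding f_def by (rule univalent_harmonic_has_derivative[OF uh that])
  have cont: "continuous_on unit_disc f"
    unfolding f_def by (intro continuous_intros holomorphic_on_imp_continuous_on D(1,2))
  have inj: "inj_on f unit_disc" using D(5) by (simp add: f_def)
  obtain k where k: "homeomorphism unit_disc (f ` unit_disc) f k"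
    using invariance_of_domain_homeomorphism[OF open_ball cont _ inj] by auto
  show thesis
  proof (rule that[OF k])
    fix z assume z: "cmod z < 1"
    define A where "A = (\<lambda>v. deriv h z * v + cnj (deriv g z * v))"
    have stretch: "(cmod (deriv h z) - cmod (deriv g z)) * cmod v \<le> cmod (A v)" for v
      unfolding A_def by (rule real_linear_stretch)
    have lin: "linear A" using df[OF z] has_derivative_linear unfolding A_def by blast
    have "inj A"
    proof (subst linear_injective_0[OF lin], intro allI impI)
      fix v assume "A v = 0"
      then show "v = 0" using stretch[of v] D(3)[OF z] by (simp add: mult_le_0_iff)
    qed
    then have "surj A" using lin linear_injective_imp_surjective by blast
    then obtain B where B: "linear B" "A \<circ> B = id" using linear_surjective_right_inverse[OF lin] by blast
    have "(k has_derivative B) (at (f z))"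
      by (rule has_derivative_inverse_strong[OF open_ball _ cont _ df[OF z, folded A_def] B(2)])
         (use z k in \<open>auto simp: homeomorphism_def\<close>)
    moreover have "(cmod (deriv h z) - cmod (deriv g z)) * cmod (B w) \<le> cmod w" for w
      using stretch[of "B w"] fun_cong[OF B(2), of w] by simp
    ultimately show "\<exists>B. (k has_derivative B) (at (f z)) \<and>
       (\<forall>w. (cmod (deriv h z) - cmod (deriv g z)) * cmod (B w) \<le> cmod w)" by blast
  qed
qed

text \<open>Pull the segment from \<open>f 0\<close> to \<open>f z\<close> back under \<open>f\<close>. The image of the disc need not contain the whole
  segment, so the pull-back \<open>y\<close> is followed only up to the first time \<open>t1\<close> at which the segment
  leaves the image of \<open>ball 0 r\<close>, where \<open>r = \<bar>z\<bar>\<close>; such a time exists because \<open>f z\<close> itself lies outside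
  that image, by injectivity. There \<open>\<bar>y t1\<bar> = r\<close>, while \<open>growth \<alpha> \<bar>y\<bar>\<close> increases at most at speed
  \<open>\<bar>f z - f 0\<bar> / c\<close>, because the derivative of \<open>growth \<alpha>\<close> is the lower bound for the stretching.\<close>

lemma norm_ge_growth:
  assumes \<alpha>: "second_coeff_bound \<alpha>" and uh: "univalent_harmonic h g" and z: "cmod z < 1"
  defines "f \<equiv> \<lambda>z. h z + cnj (g z)"
  shows "(cmod (deriv h 0) - cmod (deriv g 0)) * growth \<alpha> (cmod z) \<le> cmod (f z - f 0)"
proof (cases "z = 0")
  case True
  then show ?thesis by (simp add: growth_def)
next
  case False
  note D = univalent_harmonicD[OF uh]
  have \<alpha>0: "\<alpha> > 0" using second_coeff_bound_ge_half[OF \<alpha>] by simp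
  obtain k where k: "homeomorphism unit_disc (f ` unit_disc) f k"
    and dk: "\<And>z. cmod z < 1 \<Longrightarrow> \<exists>B. (k has_derivative B) (at (f z)) \<and>
       (\<forall>w. (cmod (deriv h z) - cmod (deriv g z)) * cmod (B w) \<le> cmod w)"
    using univalent_harmonic_inverse[OF uh] unfolding f_def by blast
  have kf: "k (f x) = x" if "cmod x < 1" for x
    using k that by (auto simp: homeomorphism_def)
  have contf: "continuous_on unit_disc f" and contk: "continuous_on (f ` unit_disc) k"
    using k by (auto simp: homeomorphism_def)
  have inj: "inj_on f unit_disc" using D(5) by (simp add: f_def)
  define r where "r = cmod z"
  have r: "0 < r" "r < 1" using z False by (auto simp: r_def)
  define c where "c = cmod (deriv h 0) - cmod (deriv g 0)"
  have c: "c > 0" using D(3)[of 0] by (simp add: c_def)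
  define W where "W = f z - f 0"
  have W: "W \<noteq> 0"
    using inj z False by (auto simp: W_def inj_on_def)
  define \<gamma> where "\<gamma> = (\<lambda>t::real. f 0 + t *\<^sub>R W)"
  have cont\<gamma>: "continuous_on A \<gamma>" for A unfolding \<gamma>_def by (intro continuous_intros)
  have openU: "open (f ` ball 0 r)"
    using r by (intro invariance_of_domain continuous_on_subset[OF contf] inj_on_subset[OF inj]) auto
  define S where "S = {0..1} \<inter> \<gamma> -` (- (f ` ball 0 r))"
  have "closed S"
    unfolding S_def using openU by (intro closed_Int closed_vimage cont\<gamma>) auto
  moreover have "f z \<notin> f ` ball 0 r"
  proof
    assume "f z \<in> f ` ball 0 r"
    then obtain w where w: "cmod w < r" "f z = f w" by auto
    then have "z = w" using z r by (intro inj_onD[OF inj w(2)]) auto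
    then show False using w by (simp add: r_def)
  qed
  then have "1 \<in> S" by (simp add: S_def \<gamma>_def W_def)
  moreover have bdd: "bdd_below S" by (rule bdd_belowI[of _ 0]) (auto simp: S_def)
  ultimately have t1S: "Inf S \<in> S" by (intro closed_contains_Inf) auto
  define t1 where "t1 = Inf S"
  have t1: "0 \<le> t1" "t1 \<le> 1" "\<gamma> t1 \<notin> f ` ball 0 r" using t1S by (auto simp: S_def t1_def)
  have "\<gamma> 0 \<in> f ` ball 0 r" using r by (auto simp: \<gamma>_def)
  then have t1_pos: "t1 > 0" using t1 by (metis less_eq_real_def)
  have before: "\<gamma> t \<in> f ` ball 0 r" if "0 \<le> t" "t < t1" for t
  proof (rule ccontr)
    assume "\<gamma> t \<notin> f ` ball 0 r"
    then have "t \<in> S" using that t1 by (auto simp: S_def)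
    then show False using cInf_lower[OF _ bdd, of t] that by (simp add: t1_def)
  qed
  have "compact (f ` cball 0 r)"
    using r by (intro compact_continuous_image continuous_on_subset[OF contf]) auto
  then have "closed (\<gamma> -` (f ` cball 0 r))" by (intro closed_vimage cont\<gamma> compact_imp_closed)
  moreover have "{0..<t1} \<subseteq> \<gamma> -` (f ` cball 0 r)" using before by fastforce
  ultimately have "closure {0..<t1} \<subseteq> \<gamma> -` (f ` cball 0 r)" by (rule closure_minimal[rotated])
  moreover have "t1 \<in> closure {0..<t1}" using t1_pos by simp
  ultimately have "\<gamma> t1 \<in> f ` cball 0 r" by blast
  then obtain x1 where x1: "cmod x1 \<le> r" "\<gamma> t1 = f x1" by auto
  have x1r: "cmod x1 = r" using x1 t1(3) by (metis image_eqI le_less mem_ball_0)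
  define y where "y = (\<lambda>t. k (\<gamma> t))"
  have img: "\<gamma> t \<in> f ` unit_disc" if "t \<in> {0..t1}" for t
    using before[of t] that x1 x1r r by (cases "t = t1") auto
  have y0: "y 0 = 0" using kf[of 0] by (simp add: y_def \<gamma>_def)
  have yt1: "cmod (y t1) = r" using kf[of x1] x1 x1r r by (simp add: y_def)
  have conty: "continuous_on {0..t1} y"
    unfolding y_def by (rule continuous_on_compose2[OF contk cont\<gamma>]) (use img in auto)
  have ylt: "cmod (y t) < 1" if "t \<in> {0..t1}" for t
    using img[OF that] kf by (auto simp: y_def)
  define N where "N = (\<lambda>t. growth \<alpha> (cmod (y t)))"
  have "\<exists>d. (N has_vector_derivative d) (at t) \<and> norm d \<le> cmod W / c" if t: "0 < t" "t < t1" for t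
  proof -
    obtain x where x: "cmod x < r" "\<gamma> t = f x" using before[of t] t by auto
    have x1: "cmod x < 1" using x r by simp
    have yx: "y t = x" using kf[OF x1] x by (simp add: y_def)
    have x0: "x \<noteq> 0" using x W t by (auto simp: \<gamma>_def)
    obtain B where B: "(k has_derivative B) (at (\<gamma> t))"
      "(cmod (deriv h x) - cmod (deriv g x)) * cmod (B W) \<le> cmod W"
      using dk[OF x1] x by auto
    define v where "v = B W"
    have "(y has_derivative (\<lambda>s. s *\<^sub>R v)) (at t)"
    proof -
      have "(\<gamma> has_derivative (\<lambda>s. s *\<^sub>R W)) (at t)"
        unfolding \<gamma>_def by (auto intro!: derivative_eq_intros)
      then have "(y has_derivative (\<lambda>s. B (s *\<^sub>R W))) (at t)"
        unfolding y_def using B(1) by (rule has_derivative_compose)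
      then show ?thesis
        using linear_scale[OF has_derivative_linear[OF B(1)]] by (simp add: v_def)
    qed
    moreover have "(norm has_derivative (\<lambda>w. inner (sgn x) w)) (at (y t))"
      using has_derivative_norm[OF x0] yx by (simp add: inner_commute)
    ultimately have "((\<lambda>t. cmod (y t)) has_derivative (\<lambda>s. inner (sgn x) (s *\<^sub>R v))) (at t)"
      by (rule has_derivative_compose)
    then have "((\<lambda>t. cmod (y t)) has_real_derivative inner (sgn x) v) (at t)"
      by (simp add: has_field_derivative_def mult.commute[of _ "inner (sgn x) v"] mult_commute_abs)
    then have "(N has_real_derivative distortion \<alpha> (cmod x) * inner (sgn x) v) (at t)"
      unfolding N_def using growth_has_derivative_distortion[of "cmod x" \<alpha>] x1 \<alpha>0 yx
      by (intro DERIV_chain2[where f = "growth \<alpha>"]) auto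
    moreover have "\<bar>distortion \<alpha> (cmod x) * inner (sgn x) v\<bar> \<le> cmod W / c"
    proof -
      have dist: "distortion \<alpha> (cmod x) \<ge> 0" using x1 by (simp add: distortion_def abs_square_le_1)
      have "\<bar>inner (sgn x) v\<bar> \<le> cmod v"
        using Cauchy_Schwarz_ineq2[of "sgn x" v] x0 by (simp add: norm_sgn)
      then have "c * (distortion \<alpha> (cmod x) * \<bar>inner (sgn x) v\<bar>) \<le> c * distortion \<alpha> (cmod x) * cmod v"
        using c dist by (simp add: mult_left_mono)
      also have "\<dots> \<le> (cmod (deriv h x) - cmod (deriv g x)) * cmod v"
        using min_stretch_ge_distortion[OF \<alpha> uh x1] unfolding c_def by (rule mult_right_mono) simp
      also have "\<dots> \<le> cmod W" using B(2) by (simp add: v_def)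
      finally show ?thesis using c dist by (simp add: abs_mult field_simps)
    qed
    ultimately show ?thesis
      unfolding has_real_derivative_iff_has_vector_derivative by auto
  qed
  then obtain N' where N': "\<And>t. 0 < t \<Longrightarrow> t < t1 \<Longrightarrow> (N has_vector_derivative N' t) (at t)"
    "\<And>t. 0 < t \<Longrightarrow> t < t1 \<Longrightarrow> norm (N' t) \<le> cmod W / c"
    by metis
  have "norm (N t1 - N 0) \<le> t1 * (cmod W / c) - 0 * (cmod W / c)"
  proof (rule differentiable_bound_general[where f' = N' and \<phi>' = "\<lambda>_. cmod W / c"])
    show "continuous_on {0..t1} N"
      unfolding N_def
    proof (rule continuous_on_compose2[where f = "\<lambda>t. cmod (y t)" and t = "{0..<1}"])
      show "continuous_on {0..<1} (growth \<alpha>)"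
        by (rule DERIV_continuous_on) (auto intro!: DERIV_subset[OF growth_has_derivative_distortion] \<alpha>0)
    qed (use conty ylt in \<open>auto intro!: continuous_intros\<close>)
    show "((\<lambda>t. t * (cmod W / c)) has_vector_derivative cmod W / c) (at t)" for t
      unfolding has_real_derivative_iff_has_vector_derivative[symmetric]
      using DERIV_cmult_right[OF DERIV_ident, of "cmod W / c"] by simp
  qed (use t1_pos N' c in \<open>auto intro!: continuous_intros\<close>)
  moreover have "N 0 = 0" "N t1 = growth \<alpha> r" by (simp_all add: N_def y0 yt1 growth_def)
  ultimately have "growth \<alpha> r \<le> t1 * (cmod W / c)" by simp
  also have "\<dots> \<le> cmod W / c" using t1 c by (intro mult_left_le_one_le) auto
  finally show ?thesis using c by (simp add: r_def W_def field_simps flip: c_def)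
qed

section \<open>Two points on a circle\<close>

lemma two_point_distortion:
  assumes \<alpha>: "second_coeff_bound \<alpha>" and uh: "univalent_harmonic h g"
    and z: "cmod z\<^sub>1 < 1" "cmod z\<^sub>2 < 1"
  defines "f \<equiv> \<lambda>z. h z + cnj (g z)"
  shows "(1 - (cmod z\<^sub>1)^2) * (cmod (deriv h z\<^sub>1) - cmod (deriv g z\<^sub>1))
      * growth \<alpha> (cmod (z\<^sub>2 - z\<^sub>1) / cmod (1 - cnj z\<^sub>1 * z\<^sub>2)) \<le> cmod (f z\<^sub>2 - f z\<^sub>1)"
proof -
  note K = univalent_harmonic_disc_aut[OF z(1) uh]
  define w where "w = disc_aut (-z\<^sub>1) z\<^sub>2"
  have "cmod w < 1" unfolding w_def by (rule disc_aut_in_disc) (use z in auto)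
  note grow = norm_ge_growth[OF \<alpha> K(1) this]
  have s: "1 - (cmod z\<^sub>1)^2 > 0" by (rule one_minus_norm_square(2)[OF z(1)])
  have "disc_aut z\<^sub>1 w = z\<^sub>2" "disc_aut z\<^sub>1 0 = z\<^sub>1"
    unfolding w_def using disc_aut_minus[OF z] by (simp_all add: disc_aut_def)
  moreover have "cmod w = cmod (z\<^sub>2 - z\<^sub>1) / cmod (1 - cnj z\<^sub>1 * z\<^sub>2)"
    by (simp add: w_def disc_aut_def norm_divide)
  moreover have "cmod (of_real (1 - (cmod z\<^sub>1)^2) * x) = (1 - (cmod z\<^sub>1)^2) * cmod x" for x :: complex
    using s by (simp only: norm_mult norm_of_real abs_of_pos)
  ultimately show ?thesis
    using grow unfolding K(2,3) f_def by (simp add: right_diff_distrib)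
qed

lemma powr_convex_with_1:
  fixes p s T :: real
  assumes "p \<ge> 1" "0 \<le> s" "s \<le> 1" "T > 0"
  shows "(1 - s + s * T) powr p \<le> 1 - s + s * T powr p"
  using convex_onD[OF powr_convex[OF assms(1)], of s 1 T] assms by simp

text \<open>Let \<open>d\<close> be the distance of the two points, \<open>c = 1 - r\<^sup>2\<close> and \<open>m = sqrt (c\<^sup>2 + d\<^sup>2)\<close>. Then
  \<open>growth \<alpha> (d / m) = (1 - ((m - d) / c) powr (2 * \<alpha>)) / (2 * \<alpha>)\<close>. Here \<open>(m - d) / c\<close> is a convex function of \<open>d\<close>, equal to
  \<open>1\<close> at \<open>d = 0\<close> and to \<open>(1 - r) / (1 + r)\<close> at \<open>d = 2 * r\<close>, so the growth bound is concave in \<open>d\<close> and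
  is at least its linear interpolation between these two points.\<close>

lemma growth_chord:
  assumes \<alpha>: "\<alpha> \<ge> 1/2" and r: "0 < r" "r < 1" and z: "cmod z\<^sub>1 = r" "cmod z\<^sub>2 = r"
  shows "cmod (z\<^sub>2 - z\<^sub>1) / (2 * r) * ((1 - ((1 - r) / (1 + r)) powr (2 * \<alpha>)) / (2 * \<alpha>))
    \<le> growth \<alpha> (cmod (z\<^sub>2 - z\<^sub>1) / cmod (1 - cnj z\<^sub>1 * z\<^sub>2))"
proof -
  define d where "d = cmod (z\<^sub>2 - z\<^sub>1)"
  define m where "m = cmod (1 - cnj z\<^sub>1 * z\<^sub>2)"
  define c where "c = 1 - r^2"
  define T where "T = (1 - r) / (1 + r)"
  define s where "s = d / (2 * r)"
  have c: "c > 0" using r by (simp add: c_def abs_square_less_1)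
  have T: "T > 0" using r by (simp add: T_def)
  have m2: "m^2 = c^2 + d^2"
    using pseudohyperbolic_less_1(3)[of z\<^sub>2 z\<^sub>1] z r by (simp add: m_def c_def d_def power2_eq_square)
  have d: "d = 2 * r * s" "0 \<le> s" using r by (auto simp: s_def d_def)
  have "d \<le> 2 * r" using norm_triangle_ineq4[of z\<^sub>2 z\<^sub>1] z by (simp add: d_def)
  then have s1: "s \<le> 1" using r by (simp add: s_def)
  have "d^2 < m^2" using m2 c by simp
  then have md: "d < m" by (rule power2_less_imp_less) (simp add: m_def)
  have m0: "m > 0" "d \<ge> 0" using md by (auto simp: d_def intro: le_less_trans[OF norm_ge_zero])
  have chord: "(m - d) / c \<le> 1 - s + s * T"
  proof -
    define R where "R = (1 - s) * c + s * (1 + r^2)"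
    have "R^2 - m^2 = 4 * s * (1 - s) * c * r^2"
      unfolding R_def m2 d(1) c_def by (simp add: algebra_simps power2_eq_square)
    moreover have "\<dots> \<ge> 0" using d s1 c by simp
    ultimately have "m^2 \<le> R^2" by linarith
    moreover have "R \<ge> 0" using d s1 c by (simp add: R_def)
    ultimately have mR: "m \<le> R" by (rule power2_le_imp_le)
    have cT: "c * T = (1 - r)^2"
      using r by (simp add: c_def T_def field_simps power2_eq_square)
    have "c * (1 - s + s * T) = (1 - s) * c + s * (c * T)" by (simp add: algebra_simps)
    also have "\<dots> = R - d"
      unfolding cT R_def d(1) by (simp add: algebra_simps power2_eq_square)
    finally have "c * (1 - s + s * T) = R - d" .
    with mR have "m - d \<le> c * (1 - s + s * T)" by linarith
    then show ?thesis using c by (simp add: field_simps)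
  qed
  have "(1 - d / m) / (1 + d / m) = ((m - d) / c)^2"
  proof -
    have eq: "(m - d) * (m + d) = c^2" using m2 by (simp add: algebra_simps power2_eq_square)
    have "(m - d) / (m + d) = (m - d)^2 / c^2"
      unfolding eq[symmetric] using md by (simp add: power2_eq_square)
    moreover have "1 - d / m = (m - d) / m" "1 + d / m = (m + d) / m"
      using m0 by (simp_all add: field_simps)
    then have "(1 - d / m) / (1 + d / m) = (m - d) / (m + d)" using m0 by simp
    ultimately show ?thesis by (simp add: power_divide)
  qed
  then have "((1 - d / m) / (1 + d / m)) powr \<alpha> = ((m - d) / c) powr (2 * \<alpha>)"
    using md c by (simp add: powr_powr[symmetric] powr_numeral)
  also have "\<dots> \<le> (1 - s + s * T) powr (2 * \<alpha>)"
    using chord md c \<alpha> by (intro powr_mono2) auto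
  also have "\<dots> \<le> 1 - s + s * T powr (2 * \<alpha>)"
    using \<alpha> d s1 T by (intro powr_convex_with_1) auto
  finally have "s * (1 - T powr (2 * \<alpha>)) \<le> 1 - ((1 - d / m) / (1 + d / m)) powr \<alpha>"
    by (simp add: algebra_simps)
  then have "s * (1 - T powr (2 * \<alpha>)) / (2 * \<alpha>) \<le> growth \<alpha> (d / m)"
    unfolding growth_def using \<alpha> by (intro divide_right_mono) auto
  then show ?thesis by (simp add: s_def T_def d_def m_def)
qed

text \<open>\<open>X\<close> is concave with \<open>X 0 = 0\<close>, so the slope \<open>X r / r\<close> is nonincreasing, and the remaining factor
  \<open>T r powr \<alpha>\<close> is positive and strictly decreasing.\<close>

lemma C_bound_strict_antimono:
  assumes \<alpha>: "\<alpha> \<ge> 1/2"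
  shows "strict_antimono_on {0<..<1} (C_bound \<alpha>)"
proof (rule monotone_onI)
  fix r R :: real assume "r \<in> {0<..<1}" "R \<in> {0<..<1}" and rR: "r < R"
  then have r: "0 < r" "r < 1" and R: "0 < R" "R < 1" by auto
  define T where "T = (\<lambda>r::real. (1 - r) / (1 + r))"
  define X where "X = (\<lambda>r. 1 - T r powr (2 * \<alpha>))"
  have T: "0 < T x" "T x < 1" if "0 < x" "x < 1" for x using that by (auto simp: T_def)
  have C: "C_bound \<alpha> x = T x powr \<alpha> * (X x / x) / (4 * \<alpha>)" for x
    by (simp add: C_bound_def T_def X_def)
  have "T R < T r" using r R rR by (simp add: T_def field_simps)
  then have strict: "T R powr \<alpha> < T r powr \<alpha>" using T R r \<alpha> by (intro powr_less_mono2) (auto intro: less_imp_le)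
  define s where "s = r / R"
  have s: "0 \<le> s" "s \<le> 1" "r = s * R" using r R rR by (auto simp: s_def)
  have "T r \<le> 1 - s + s * T R"
  proof -
    have "1 - s + s * T R - T r = 2 * s * R * (R * (1 - s)) / ((1 + R) * (1 + s * R))"
      using R s r unfolding T_def s(3) by (simp add: divide_simps add_pos_nonneg) (simp add: algebra_simps)
    moreover have "\<dots> \<ge> 0" using R s by simp
    ultimately show ?thesis by linarith
  qed
  then have "T r powr (2 * \<alpha>) \<le> (1 - s + s * T R) powr (2 * \<alpha>)"
    using T[OF r] \<alpha> by (intro powr_mono2) auto
  also have "\<dots> \<le> 1 - s + s * T R powr (2 * \<alpha>)"
    using \<alpha> s T[OF R] by (intro powr_convex_with_1) auto
  finally have "s * X R \<le> X r" by (simp add: X_def algebra_simps)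
  then have "X R / R \<le> X r / r" using r R by (simp add: s_def field_simps)
  moreover have "X R > 0"
    using T[OF R] \<alpha> powr_less_mono2[of "2 * \<alpha>" "T R" 1] by (simp add: X_def)
  ultimately have "T R powr \<alpha> * (X R / R) < T r powr \<alpha> * (X r / r)"
    using strict R T[OF r] by (intro mult_less_le_imp_less) auto
  then show "C_bound \<alpha> R < C_bound \<alpha> r"
    unfolding C using \<alpha> by (intro divide_strict_right_mono) auto
qed

theorem lemma1:
  fixes \<alpha> :: real
  defines "\<alpha> \<equiv> family_ord S_H"
  shows "strict_antimono_on {0<..<1} (C_bound \<alpha>) \<and>
    (\<forall>f\<in>S_H0. \<forall>r\<in>{0<..<1}. \<forall>z\<^sub>1 z\<^sub>2. cmod z\<^sub>1 = r \<longrightarrow> cmod z\<^sub>2 = r \<longrightarrow>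
       cmod (f z\<^sub>2 - f z\<^sub>1) \<ge> cmod (z\<^sub>2 - z\<^sub>1) * C_bound \<alpha> r)"
proof (intro conjI ballI allI impI)
  have \<alpha>: "second_coeff_bound \<alpha>" unfolding \<alpha>_def by (rule second_coeff_bound_family_ord)
  have \<alpha>2: "\<alpha> \<ge> 1/2" by (rule second_coeff_bound_ge_half[OF \<alpha>])
  show "strict_antimono_on {0<..<1} (C_bound \<alpha>)" by (rule C_bound_strict_antimono[OF \<alpha>2])
  fix f r z\<^sub>1 z\<^sub>2
  assume f: "f \<in> S_H0" and "r \<in> {0<..<1}" and z: "cmod z\<^sub>1 = r" "cmod z\<^sub>2 = r"
  then have r: "0 < r" "r < 1" by auto
  obtain h g where rep: "canonical_rep f h g" and uh: "univalent_harmonic h g" and h0: "deriv h 0 = 1"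
    using f S_H_obtain unfolding S_H0_def by blast
  have g0: "deriv g 0 = 0"
    using f canonical_rep_deriv_unique(2)[OF rep, of _ _ 0] unfolding S_H0_def by auto
  define T where "T = (1 - r) / (1 + r)"
  define \<mu> where "\<mu> = cmod (deriv h z\<^sub>1) - cmod (deriv g z\<^sub>1)"
  define \<Phi> where "\<Phi> = cmod (z\<^sub>2 - z\<^sub>1) / (2 * r) * ((1 - T powr (2 * \<alpha>)) / (2 * \<alpha>))"
  have s: "1 - r^2 > 0" using r by (simp add: abs_square_less_1)
  have "distortion \<alpha> r \<le> \<mu>"
    using min_stretch_ge_distortion[OF \<alpha> uh, of z\<^sub>1] z r by (simp add: h0 g0 \<mu>_def)
  then have \<mu>: "T powr \<alpha> \<le> (1 - r^2) * \<mu>"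
    using s by (simp add: distortion_def T_def field_simps)
  have "T powr (2 * \<alpha>) \<le> 1" using r \<alpha>2 by (intro powr_le1) (auto simp: T_def)
  then have \<Phi>0: "\<Phi> \<ge> 0" using r \<alpha>2 by (simp add: \<Phi>_def)
  have "cmod (z\<^sub>2 - z\<^sub>1) * C_bound \<alpha> r = T powr \<alpha> * \<Phi>"
    by (simp add: C_bound_def \<Phi>_def T_def mult_ac)
  also have "\<dots> \<le> ((1 - r^2) * \<mu>) * \<Phi>" by (rule mult_right_mono[OF \<mu> \<Phi>0])
  also have "\<dots> \<le> ((1 - r^2) * \<mu>) * growth \<alpha> (cmod (z\<^sub>2 - z\<^sub>1) / cmod (1 - cnj z\<^sub>1 * z\<^sub>2))"
    using growth_chord[OF \<alpha>2 r z] \<mu> by (intro mult_left_mono) (auto simp: \<Phi>_def T_def intro: order_trans[OF powr_ge_zero])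
  also have "\<dots> \<le> cmod (f z\<^sub>2 - f z\<^sub>1)"
    using two_point_distortion[OF \<alpha> uh, of z\<^sub>1 z\<^sub>2] z r rep by (simp add: \<mu>_def canonical_rep_def)
  finally show "cmod (f z\<^sub>2 - f z\<^sub>1) \<ge> cmod (z\<^sub>2 - z\<^sub>1) * C_bound \<alpha> r" .
qed

end
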